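(* Let $B_0\subseteq\mathbb S_O$ be a finite baseline premise base and $\tilde B_0=(B_0\setminus B_0^-)\cup B_0^+$ a noisy premise base, with $m:=|B_0|$, $\tilde m:=|\tilde B_0|$ and $\mathcal N:=|B_0^-|+|B_0^+|$. Assume bounded and effectively describable noise, and serializability. Let $q$ be derivable from $\tilde B_0$ with noisy depth $\tilde n:=\mathrm{Dd}(q\mid\tilde B_0)$ satisfying $\log\tilde m\le\tilde n\le\mathrm{poly}(\tilde m)$. Assume that $(q,\tilde B_0)$ lies in the information-rich regime, that $\mathcal P$ satisfies the richness condition with parameter $\delta_0>0$, and that $q$ is generic/incompressible at its scale, i.e. with $n':=N(q\mid\tilde B_0)$, $K(q\mid\langle\tilde B_0\rangle)\ge(1-\delta)n'\log(\tilde m+n')$ for some $\delta>\delta_0$. Then: (i) $H_{\mathrm{derive}}(q\mid\tilde B_0)=\Theta\!\left(\dfrac{H_K(q\mid\tilde B_0)}{\log(\tilde m+\tilde n)}\right)$; (ii) $\bigl|H_K(q\mid\tilde B_0)-H_K(q\mid B_0)\bigr|\le O\bigl(\mathcal N\log(m+\mathcal N)\bigr)$.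
   Context: $\log=\log_2$; $\mathrm{poly}$ denotes a fixed polynomial bound; constants do not depend on the particular instance. $\mathcal P$ is a fixed effective proof system (decidable proof checking, finite rule set of bounded arity) for $\mathcal L$ = many-sorted FO(LFP); $\mathrm{Cn}(\Gamma)$ is the set of formulas derivable from the finite set $\Gamma$. $\mathbb S_O$ is an ambient set of formulas with finite binary encodings, decidable equality and effectively evaluable predicates. A premise base is a finite effectively listable $B\subseteq\mathbb S_O$ with decidable membership and canonical computable encoding $\langle B\rangle$. Depth: $P_O$ assigns to each $s\in\mathbb S_O$ a finite set $P_O(s)\subseteq\mathbb S_O$ computable from its encoding, with no infinite backward chain; for $s\in\mathbb S_O\setminus B$, $P_O(s)$ is exactly the set of immediate premises in a fixed normal-form single-step inference of $\mathcal P$ concluding $s$. $\mathrm{Dd}(s\mid B)=0$ if $s\in B$, else $1+\max_{s'\in P_O(s)}\mathrm{Dd}(s'\mid B)$ (with $\max\varnothing=0$). Traces: a derivation trace of $q$ from $B$ is $\pi=((r_1,\vec p_1),\dots,(r_\ell,\vec p_\ell);o)$ with $r_i$ rule identifiers, $\vec p_i$ vectors of indices, $o$ an index, such that the following replay outputs $q$: $P_0$ is the list of elements of $B$ in canonical order; at step $i$ rule $r_i$ is applied to the formulas of the pool $P_{i-1}$ indexed by $\vec p_i$, and its conclusion is appended to give $P_i$; the output is the formula at index $o$ of $P_\ell$. Each rule application must be correct. Length $|\pi|=\ell$; $N(q\mid B)$ is the minimum length of a trace deriving $q$ from $B$. $K(\cdot\mid\cdot)$ is prefix-free conditional Kolmogorov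 complexity; $H_{\mathrm{derive}}(q\mid B)=\mathrm{Dd}(q\mid B)\ln2$, $H_K(q\mid B)=K(q\mid\langle B\rangle)\ln2$. Noisy base: $B_0^-\subseteq B_0$ (lost premises) and $B_0^+\subseteq\mathbb S_O\setminus B_0$ (spurious premises) are finite. Bounded and effectively describable noise: (a) there is a computable family of universes $\{\mathcal V_s\}_{s\in\mathbb N}$, $\mathcal V_s\subseteq\mathbb S_O$, with canonical indexing, $|\mathcal V_s|\le\mathrm{poly}(s)$ and $B_0\cup B_0^+\subseteq\mathcal V_{m+\mathcal N}$ (so each element of $B_0\cup B_0^+$ is named by an index of $O(\log(m+\mathcal N))$ bits); (b) given either $\langle B_0\rangle$ or $\langle\tilde B_0\rangle$, the sets $B_0^-$, $B_0^+$ are effectively describable (with decidable membership) by index lists over $\mathcal V_{m+\mathcal N}$ of total length $O(\mathcal N\log(m+\mathcal N))$. Serializability: there are constants $c_{\min},c_{\max}>0$ such that for all $(q,B)$ in the class considered with $q\in\mathrm{Cn}(B)$ and $\mathrm{Dd}(q\mid B)<\infty$, $c_{\min}\mathrm{Dd}(q\mid B)\le N(q\mid B)\le c_{\max}\mathrm{Dd}(q\mid B)$. Information-rich regime: $K(q\mid\langle B\rangle)=\omega(\log|B|)$ along the family of instances as $|B|\to\infty$. Richness with parameter $\delta_0$: there is $m_0$ such that for all $m\ge m_0$, all integers $n$ with $\log m\le n\le\mathrm{poly}(m)$ and all premise bases $B$ with $|B|=m$, $|\{\langle q\rangle:N(q\mid B)=n\}|\ge2^{(1-\delta_0)n\log(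m+n)}$.
   Formalization: The parameter δ is required to satisfy δ < 1 (for δ ≥ 1 the incompressibility condition is vacuous and (i) fails), and (i) is stated with uniform constants for all noisy bases with m̃ ≥ 2. *)

theory Defs
  imports
    Complex_Main
    "HOL-Library.Nat_Bijection"
    "HOL-Library.Log_Nat"
    "HOL-Library.Sublist"
    "HOL-Library.Landau_Symbols"
    "HOL-Computational_Algebra.Polynomial"
begin

section \<open>Computability\<close>

text \<open>Partial recursive functions in their unary presentation: several arguments are packed
  with \<^const>\<open>prod_encode\<close>, finite lists with \<^const>\<open>list_encode\<close>.\<close>

fun prim_rec :: "(nat \<rightharpoonup> nat) \<Rightarrow> (nat \<rightharpoonup> nat) \<Rightarrow> nat \<Rightarrow> nat \<Rightarrow> nat option" where
  "prim_rec f g a 0 = f a"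
| "prim_rec f g a (Suc k) =
     Option.bind (prim_rec f g a k) (\<lambda>y. g (prod_encode (a, prod_encode (k, y))))"

definition minimise :: "(nat \<rightharpoonup> nat) \<Rightarrow> nat \<rightharpoonup> nat" where
  "minimise f a =
     (if \<exists>n. f (prod_encode (a, n)) = Some 0 \<and>
             (\<forall>k<n. \<exists>v. f (prod_encode (a, k)) = Some (Suc v))
      then Some (LEAST n. f (prod_encode (a, n)) = Some 0) else None)"

inductive partial_recursive :: "(nat \<rightharpoonup> nat) \<Rightarrow> bool" where
  zero: "partial_recursive (\<lambda>_. Some 0)"
| succ: "partial_recursive (\<lambda>n. Some (Suc n))"
| left: "partial_recursive (\<lambda>n. Some (fst (prod_decode n)))"
| right: "partial_recursive (\<lambda>n. Some (snd (prod_decode n)))"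
| pair: "partial_recursive f \<Longrightarrow> partial_recursive g \<Longrightarrow>
    partial_recursive (\<lambda>n. Option.bind (f n) (\<lambda>a. map_option (\<lambda>b. prod_encode (a, b)) (g n)))"
| comp: "partial_recursive f \<Longrightarrow> partial_recursive g \<Longrightarrow> partial_recursive (f \<circ>\<^sub>m g)"
| prec: "partial_recursive f \<Longrightarrow> partial_recursive g \<Longrightarrow>
    partial_recursive (\<lambda>n. prim_rec f g (fst (prod_decode n)) (snd (prod_decode n)))"
| mu: "partial_recursive f \<Longrightarrow> partial_recursive (minimise f)"

definition decidable_set :: "nat set \<Rightarrow> bool" where
  "decidable_set A \<longleftrightarrow>
     (\<exists>F. partial_recursive F \<and> (\<forall>n. F n = Some (if n \<in> A then 1 else 0)))"

type_synonym bits = "bool list"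

definition bits_code :: "bits \<Rightarrow> nat" where
  "bits_code bs = list_encode (map of_bool bs)"

section \<open>Prefix-free conditional Kolmogorov complexity\<close>

text \<open>A machine maps a program and a condition to an output.\<close>

type_synonym machine = "bits \<Rightarrow> bits \<Rightarrow> bits option"

definition prefix_machine :: "machine \<Rightarrow> bool" where
  "prefix_machine V \<longleftrightarrow>
     (\<exists>F. partial_recursive F \<and>
        (\<forall>p y. F (prod_encode (bits_code p, bits_code y)) = map_option bits_code (V p y))) \<and>
     (\<forall>y p p'. V p y \<noteq> None \<longrightarrow> V p' y \<noteq> None \<longrightarrow> prefix p p' \<longrightarrow> p = p')"

definition optimal_prefix_machine :: "machine \<Rightarrow> bool" where
  "optimal_prefix_machine U \<longleftrightarrow> prefix_machine U \<and>
     (\<forall>V. prefix_machine V \<longrightarrow>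
        (\<exists>c. \<forall>p y x. V p y = Some x \<longrightarrow>
           (\<exists>p'. U p' y = Some x \<and> length p' \<le> length p + c)))"

definition KC :: "machine \<Rightarrow> bits \<Rightarrow> bits \<Rightarrow> nat" where
  "KC U x y = (LEAST n. \<exists>p. length p = n \<and> U p y = Some x)"

section \<open>Many-sorted first-order logic with least fixed points\<close>

text \<open>\<open>'s\<close>, \<open>'f\<close>, \<open>'r\<close> are the sorts, function symbols and relation symbols. Individual
  variables carry a sort and relation variables the list of sorts of their arguments.
  \<open>Lfp n xs \<phi> ts\<close> is \<open>[lfp X, xs. \<phi>](ts)\<close>, where \<open>X\<close> is the relation variable \<open>n\<close> of the sorts
  of \<open>xs\<close>.\<close>

datatype ('s, 'f) trm = Var nat 's | Fn 'f "('s, 'f) trm list"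

datatype ('s, 'f, 'r) fm =
    Eq "('s, 'f) trm" "('s, 'f) trm"
  | Rel 'r "('s, 'f) trm list"
  | RVar nat "'s list" "('s, 'f) trm list"
  | Neg "('s, 'f, 'r) fm"
  | And "('s, 'f, 'r) fm" "('s, 'f, 'r) fm"
  | Or "('s, 'f, 'r) fm" "('s, 'f, 'r) fm"
  | Imp "('s, 'f, 'r) fm" "('s, 'f, 'r) fm"
  | All nat 's "('s, 'f, 'r) fm"
  | Ex nat 's "('s, 'f, 'r) fm"
  | Lfp nat "(nat \<times> 's) list" "('s, 'f, 'r) fm" "('s, 'f) trm list"

text \<open>A signature gives the argument sorts and result sort of each function symbol and the
  argument sorts of each relation symbol.\<close>

type_synonym ('s, 'f, 'r) signature = "('f \<Rightarrow> 's list \<times> 's) \<times> ('r \<Rightarrow> 's list)"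

primrec sort_of :: "('s, 'f, 'r) signature \<Rightarrow> ('s, 'f) trm \<Rightarrow> 's option" where
  "sort_of S (Var x s) = Some s"
| "sort_of S (Fn f ts) =
     (if map (sort_of S) ts = map Some (fst (fst S f)) then Some (snd (fst S f)) else None)"

text \<open>\<open>occurs b X \<phi>\<close>: the relation variable \<open>X\<close> has a free occurrence in \<open>\<phi>\<close> that is positive
  (\<open>b = True\<close>) or negative (\<open>b = False\<close>).\<close>

primrec occurs :: "bool \<Rightarrow> nat \<times> 's list \<Rightarrow> ('s, 'f, 'r) fm \<Rightarrow> bool" where
  "occurs b X (Eq t u) = False"
| "occurs b X (Rel r ts) = False"
| "occurs b X (RVar n ss ts) = (b \<and> X = (n, ss))"
| "occurs b X (Neg \<phi>) = occurs (\<not> b) X \<phi>"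
| "occurs b X (And \<phi> \<psi>) = (occurs b X \<phi> \<or> occurs b X \<psi>)"
| "occurs b X (Or \<phi> \<psi>) = (occurs b X \<phi> \<or> occurs b X \<psi>)"
| "occurs b X (Imp \<phi> \<psi>) = (occurs (\<not> b) X \<phi> \<or> occurs b X \<psi>)"
| "occurs b X (All x s \<phi>) = occurs b X \<phi>"
| "occurs b X (Ex x s \<phi>) = occurs b X \<phi>"
| "occurs b X (Lfp n xs \<phi> ts) = (X \<noteq> (n, map snd xs) \<and> occurs b X \<phi>)"

primrec wf_fm :: "('s, 'f, 'r) signature \<Rightarrow> ('s, 'f, 'r) fm \<Rightarrow> bool" where
  "wf_fm S (Eq t u) = (sort_of S t \<noteq> None \<and> sort_of S t = sort_of S u)"
| "wf_fm S (Rel r ts) = (map (sort_of S) ts = map Some (snd S r))"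
| "wf_fm S (RVar n ss ts) = (map (sort_of S) ts = map Some ss)"
| "wf_fm S (Neg \<phi>) = wf_fm S \<phi>"
| "wf_fm S (And \<phi> \<psi>) = (wf_fm S \<phi> \<and> wf_fm S \<psi>)"
| "wf_fm S (Or \<phi> \<psi>) = (wf_fm S \<phi> \<and> wf_fm S \<psi>)"
| "wf_fm S (Imp \<phi> \<psi>) = (wf_fm S \<phi> \<and> wf_fm S \<psi>)"
| "wf_fm S (All x s \<phi>) = wf_fm S \<phi>"
| "wf_fm S (Ex x s \<phi>) = wf_fm S \<phi>"
| "wf_fm S (Lfp n xs \<phi> ts) =
     (distinct xs \<and> wf_fm S \<phi> \<and> \<not> occurs False (n, map snd xs) \<phi> \<and>
      map (sort_of S) ts = map Some (map snd xs))"

section \<open>The proof system\<close>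

text \<open>A rule sends a vector of premises to its conclusion, or is not applicable. Rule
  identifiers are positions in the list of rules.\<close>

type_synonym ('s, 'f, 'r) rule = "('s, 'f, 'r) fm list \<rightharpoonup> ('s, 'f, 'r) fm"

type_synonym ('s, 'f, 'r) encoding = "('s, 'f, 'r) fm \<Rightarrow> bits"

text \<open>Codes of formulas being injective, equality of formulas is decidable on codes. The
  function \<open>F\<close> below decides whether a rule applies and computes its conclusion.\<close>

definition effective_proof_system ::
  "('s, 'f, 'r) signature \<Rightarrow> ('s, 'f, 'r) encoding \<Rightarrow> ('s, 'f, 'r) rule list \<Rightarrow> bool" where
  "effective_proof_system S enc rules \<longleftrightarrow>
     inj_on enc {\<phi>. wf_fm S \<phi>} \<and>
     (\<forall>R\<in>set rules. \<forall>ps c. R ps = Some c \<longrightarrow> (\<forall>p\<in>set ps. wf_fm S p) \<longrightarrow> wf_fm S c) \<and>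
     (\<exists>a. \<forall>R\<in>set rules. \<forall>ps c. R ps = Some c \<longrightarrow> length ps \<le> a) \<and>
     (\<exists>F. partial_recursive F \<and>
        (\<forall>r<length rules. \<forall>ps. (\<forall>p\<in>set ps. wf_fm S p) \<longrightarrow>
           F (prod_encode (r, list_encode (map (bits_code \<circ> enc) ps))) =
             Some (case (rules ! r) ps of None \<Rightarrow> 0 | Some c \<Rightarrow> Suc (bits_code (enc c)))))"

inductive_set Cn :: "('s, 'f, 'r) rule list \<Rightarrow> ('s, 'f, 'r) fm set \<Rightarrow> ('s, 'f, 'r) fm set"
  for rules :: "('s, 'f, 'r) rule list" and \<Gamma> :: "('s, 'f, 'r) fm set" where
  premise: "\<phi> \<in> \<Gamma> \<Longrightarrow> \<phi> \<in> Cn rules \<Gamma>"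
| inference: "R \<in> set rules \<Longrightarrow> (\<forall>p\<in>set ps. p \<in> Cn rules \<Gamma>) \<Longrightarrow> R ps = Some \<phi> \<Longrightarrow> \<phi> \<in> Cn rules \<Gamma>"

definition effective_ambient_set ::
  "('s, 'f, 'r) signature \<Rightarrow> ('s, 'f, 'r) encoding \<Rightarrow> ('s, 'f, 'r) fm set \<Rightarrow> bool" where
  "effective_ambient_set S enc SO \<longleftrightarrow>
     SO \<subseteq> {\<phi>. wf_fm S \<phi>} \<and> decidable_set ((bits_code \<circ> enc) ` SO)"

section \<open>Premise bases\<close>

definition premise_base :: "('s, 'f, 'r) fm set \<Rightarrow> ('s, 'f, 'r) fm set \<Rightarrow> bool" where
  "premise_base SO B \<longleftrightarrow> finite B \<and> B \<subseteq> SO"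

text \<open>\<open>blist B\<close> lists \<open>B\<close> in canonical order and \<open>bcode B\<close> is the canonical encoding of \<open>B\<close>. The
  code effectively yields the listing (hence a decision of membership), and it is effectively
  obtained from any listing of \<open>B\<close>, in whatever order and with whatever repetitions.\<close>

definition canonical_base_coding ::
  "('s, 'f, 'r) encoding \<Rightarrow> ('s, 'f, 'r) fm set \<Rightarrow>
   (('s, 'f, 'r) fm set \<Rightarrow> ('s, 'f, 'r) fm list) \<Rightarrow> (('s, 'f, 'r) fm set \<Rightarrow> bits) \<Rightarrow> bool" where
  "canonical_base_coding enc SO blist bcode \<longleftrightarrow>
     (\<forall>B. premise_base SO B \<longrightarrow> set (blist B) = B \<and> distinct (blist B)) \<and>
     (\<exists>F. partial_recursive F \<and>
        (\<forall>B. premise_base SO B \<longrightarrow>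
           F (bits_code (bcode B)) = Some (list_encode (map (bits_code \<circ> enc) (blist B))))) \<and>
     (\<exists>G. partial_recursive G \<and>
        (\<forall>ss. premise_base SO (set ss) \<longrightarrow>
           G (list_encode (map (bits_code \<circ> enc) ss)) = Some (bits_code (bcode (set ss)))))"

section \<open>Derivation depth\<close>

definition backward_structure ::
  "('s, 'f, 'r) encoding \<Rightarrow> ('s, 'f, 'r) fm set \<Rightarrow>
   (('s, 'f, 'r) fm \<Rightarrow> ('s, 'f, 'r) fm set) \<Rightarrow> bool" where
  "backward_structure enc SO PO \<longleftrightarrow>
     (\<forall>s\<in>SO. finite (PO s) \<and> PO s \<subseteq> SO) \<and>
     wf {(s', s). s \<in> SO \<and> s' \<in> PO s} \<and>
     (\<exists>F. partial_recursive F \<and>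
        (\<forall>s\<in>SO. \<exists>ps. set ps = PO s \<and>
           F (bits_code (enc s)) = Some (list_encode (map (bits_code \<circ> enc) ps))))"

definition normal_form_premises ::
  "('s, 'f, 'r) rule list \<Rightarrow> ('s, 'f, 'r) fm set \<Rightarrow>
   (('s, 'f, 'r) fm \<Rightarrow> ('s, 'f, 'r) fm set) \<Rightarrow> ('s, 'f, 'r) fm set \<Rightarrow> bool" where
  "normal_form_premises rules SO PO B \<longleftrightarrow>
     (\<forall>s\<in>SO - B. \<exists>R\<in>set rules. \<exists>ps. R ps = Some s \<and> set ps = PO s)"

text \<open>For a backward structure, every element of \<open>SO\<close> has finite depth, so a natural number
  suffices as the value.\<close>

definition Dd ::
  "('s, 'f, 'r) fm set \<Rightarrow> (('s, 'f, 'r) fm \<Rightarrow> ('s, 'f, 'r) fm set) \<Rightarrow>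
   ('s, 'f, 'r) fm \<Rightarrow> ('s, 'f, 'r) fm set \<Rightarrow> nat" where
  "Dd SO PO q B =
     wfrec {(s', s). s \<in> SO \<and> s' \<in> PO s}
       (\<lambda>d s. if s \<in> B then 0 else 1 + Max (insert 0 (d ` PO s))) q"

section \<open>Derivation traces\<close>

text \<open>Steps (rule identifier, index vector) and an output index; indices count from 0.\<close>

type_synonym trace = "(nat \<times> nat list) list \<times> nat"

fun replay ::
  "('s, 'f, 'r) rule list \<Rightarrow> ('s, 'f, 'r) fm list \<Rightarrow> (nat \<times> nat list) list \<Rightarrow>
   ('s, 'f, 'r) fm list option" where
  "replay rules pool [] = Some pool"
| "replay rules pool ((r, is) # steps) =
     (if r < length rules \<and> (\<forall>i\<in>set is. i < length pool)
      then (case (rules ! r) (map (\<lambda>i. pool ! i) is) of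
              None \<Rightarrow> None
            | Some c \<Rightarrow> replay rules (pool @ [c]) steps)
      else None)"

definition derives ::
  "('s, 'f, 'r) rule list \<Rightarrow> (('s, 'f, 'r) fm set \<Rightarrow> ('s, 'f, 'r) fm list) \<Rightarrow>
   trace \<Rightarrow> ('s, 'f, 'r) fm set \<Rightarrow> ('s, 'f, 'r) fm \<Rightarrow> bool" where
  "derives rules blist \<pi> B q \<longleftrightarrow>
     (\<exists>pool. replay rules (blist B) (fst \<pi>) = Some pool \<and>
        snd \<pi> < length pool \<and> pool ! snd \<pi> = q)"

text \<open>Meaningful only if \<open>q\<close> has a trace from \<open>B\<close>, that is, if \<open>q \<in> Cn rules B\<close>.\<close>

definition trace_length ::
  "('s, 'f, 'r) rule list \<Rightarrow> (('s, 'f, 'r) fm set \<Rightarrow> ('s, 'f, 'r) fm list) \<Rightarrow>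
   ('s, 'f, 'r) fm \<Rightarrow> ('s, 'f, 'r) fm set \<Rightarrow> nat" where
  "trace_length rules blist q B = (LEAST l. \<exists>\<pi>. length (fst \<pi>) = l \<and> derives rules blist \<pi> B q)"

section \<open>Entropies\<close>

definition H_derive ::
  "('s, 'f, 'r) fm set \<Rightarrow> (('s, 'f, 'r) fm \<Rightarrow> ('s, 'f, 'r) fm set) \<Rightarrow>
   ('s, 'f, 'r) fm \<Rightarrow> ('s, 'f, 'r) fm set \<Rightarrow> real" where
  "H_derive SO PO q B = real (Dd SO PO q B) * ln 2"

definition H_K ::
  "machine \<Rightarrow> ('s, 'f, 'r) encoding \<Rightarrow> (('s, 'f, 'r) fm set \<Rightarrow> bits) \<Rightarrow>
   ('s, 'f, 'r) fm \<Rightarrow> ('s, 'f, 'r) fm set \<Rightarrow> real" where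
  "H_K U enc bcode q B = real (KC U (enc q) (bcode B)) * ln 2"

section \<open>Hypotheses on classes and families of instances\<close>

definition serializable ::
  "('s, 'f, 'r) rule list \<Rightarrow> (('s, 'f, 'r) fm set \<Rightarrow> ('s, 'f, 'r) fm list) \<Rightarrow>
   ('s, 'f, 'r) fm set \<Rightarrow> (('s, 'f, 'r) fm \<Rightarrow> ('s, 'f, 'r) fm set) \<Rightarrow>
   (('s, 'f, 'r) fm \<times> ('s, 'f, 'r) fm set) set \<Rightarrow> bool" where
  "serializable rules blist SO PO C \<longleftrightarrow>
     (\<exists>cmin cmax. 0 < cmin \<and> 0 < cmax \<and>
        (\<forall>(q, B)\<in>C. q \<in> Cn rules B \<longrightarrow>
           cmin * real (Dd SO PO q B) \<le> real (trace_length rules blist q B) \<and>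
           real (trace_length rules blist q B) \<le> cmax * real (Dd SO PO q B)))"

definition information_rich ::
  "machine \<Rightarrow> ('s, 'f, 'r) encoding \<Rightarrow> (('s, 'f, 'r) fm set \<Rightarrow> bits) \<Rightarrow>
   ('i \<Rightarrow> ('s, 'f, 'r) fm) \<Rightarrow> ('i \<Rightarrow> ('s, 'f, 'r) fm set) \<Rightarrow> bool" where
  "information_rich U enc bcode q B \<longleftrightarrow>
     (\<lambda>i. real (KC U (enc (q i)) (bcode (B i))))
       \<in> \<omega>[filtercomap (\<lambda>i. card (B i)) at_top](\<lambda>i. log 2 (real (card (B i))))"

definition rich ::
  "('s, 'f, 'r) rule list \<Rightarrow> ('s, 'f, 'r) encoding \<Rightarrow>
   (('s, 'f, 'r) fm set \<Rightarrow> ('s, 'f, 'r) fm list) \<Rightarrow> ('s, 'f, 'r) fm set \<Rightarrow>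
   real poly \<Rightarrow> real \<Rightarrow> bool" where
  "rich rules enc blist SO P \<delta>\<^sub>0 \<longleftrightarrow>
     (\<exists>m\<^sub>0. \<forall>m n B. m\<^sub>0 \<le> m \<longrightarrow> log 2 (real m) \<le> real n \<longrightarrow> real n \<le> poly P (real m) \<longrightarrow>
        premise_base SO B \<longrightarrow> card B = m \<longrightarrow>
        2 powr ((1 - \<delta>\<^sub>0) * real n * log 2 (real (m + n)))
          \<le> real (card {enc q | q. q \<in> SO \<and> q \<in> Cn rules B \<and> trace_length rules blist q B = n}))"

section \<open>Bounded and effectively describable noise\<close>

text \<open>\<open>V s\<close> lists the universe of scale \<open>s\<close> in its canonical indexing.\<close>

definition computable_universes ::
  "('s, 'f, 'r) encoding \<Rightarrow> ('s, 'f, 'r) fm set \<Rightarrow> real poly \<Rightarrow>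
   (nat \<Rightarrow> ('s, 'f, 'r) fm list) \<Rightarrow> bool" where
  "computable_universes enc SO P V \<longleftrightarrow>
     (\<forall>s. distinct (V s) \<and> set (V s) \<subseteq> SO \<and> real (length (V s)) \<le> poly P (real s)) \<and>
     (\<exists>F. partial_recursive F \<and>
        (\<forall>s. F s = Some (list_encode (map (bits_code \<circ> enc) (V s)))))"

text \<open>Number of binary digits; the index 0 is written with one digit.\<close>

definition index_length :: "nat \<Rightarrow> nat" where
  "index_length i = max 1 (floorlog 2 i)"

text \<open>The algorithms \<open>F\<close> and \<open>F'\<close> recover both noise sets from two index lists together with the
  baseline base (\<open>F\<close>) or the noisy base (\<open>F'\<close>). They return the canonical encodings, which
  effectively determine membership.\<close>

definition describable_noise ::
  "(('s, 'f, 'r) fm set \<Rightarrow> bits) \<Rightarrow> (nat \<Rightarrow> ('s, 'f, 'r) fm list) \<Rightarrow>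
   ('i \<Rightarrow> ('s, 'f, 'r) fm set) \<Rightarrow> ('i \<Rightarrow> ('s, 'f, 'r) fm set) \<Rightarrow>
   ('i \<Rightarrow> ('s, 'f, 'r) fm set) \<Rightarrow> bool" where
  "describable_noise bcode V B0 Bminus Bplus \<longleftrightarrow>
     (\<exists>F F' c. partial_recursive F \<and> partial_recursive F' \<and>
        (\<forall>i. let m = card (B0 i); \<N> = card (Bminus i) + card (Bplus i); U = V (m + \<N>);
                 Bt = (B0 i - Bminus i) \<union> Bplus i;
                 noise_code =
                   prod_encode (bits_code (bcode (Bminus i)), bits_code (bcode (Bplus i)))
         in \<exists>I J.
              (\<forall>j\<in>set I \<union> set J. j < length U) \<and>
              Bminus i = (\<lambda>j. U ! j) ` set I \<and>
              Bplus i = (\<lambda>j. U ! j) ` set J \<and>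
              real (sum_list (map index_length (I @ J)))
                \<le> c * real \<N> * log 2 (real (m + \<N>)) \<and>
              F (prod_encode (bits_code (bcode (B0 i)),
                  prod_encode (list_encode I, list_encode J))) = Some noise_code \<and>
              F' (prod_encode (bits_code (bcode Bt),
                  prod_encode (list_encode I, list_encode J))) = Some noise_code))"

end

theory Submission
  imports Defs
begin

text \<open>If \<open>\<phi>\<close> is partial recursive on conditions, then \<open>p, y \<mapsto> U p (\<phi> y)\<close> is a prefix machine,
  so replacing the condition \<open>y\<close> by \<open>\<phi> y\<close> lowers the complexity of any output by at most a constant.
  Hence data need never be coded self-delimitingly into a program: an index is built inside the
  condition, one binary digit at a time, each digit being the choice between two such \<open>\<phi>\<close>.
  Replaying a minimal trace of length \<open>n'\<close> in this way takes \<open>O(n' log (m + n'))\<close> changes of the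
  condition, which is the upper bound in (i); the lower bound is genericity, and serializability
  exchanges \<open>n'\<close> with the depth. For (ii) the index lists of the noise are built in the condition
  and the noisy base is exchanged with the baseline base, in either direction. The additive
  constant is absorbed because nonempty noise has an index list of at least one digit.\<close>

section \<open>Computable functions\<close>

text \<open>Total functions get a predicate of their own so that their closure rules can be chained
  as introduction rules; partiality is confined to the few places where an assumed algorithm or
  \<open>minimise\<close> is run.\<close>

definition computable :: "(nat \<Rightarrow> nat) \<Rightarrow> bool" where
  "computable f \<longleftrightarrow> partial_recursive (\<lambda>n. Some (f n))"

abbreviation first :: "nat \<Rightarrow> nat" where "first n \<equiv> fst (prod_decode n)"
abbreviation second :: "nat \<Rightarrow> nat" where "second n \<equiv> snd (prod_decode n)"

named_theorems computable_intros

lemma partial_recursive_compose: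
  assumes "partial_recursive F" "computable f"
  shows "partial_recursive (\<lambda>n. F (f n))"
  using partial_recursive.comp[OF assms[unfolded computable_def]]
  by (simp add: map_comp_def)

lemma computable_compose:
  assumes "computable f" "computable g"
  shows "computable (\<lambda>n. f (g n))"
  using partial_recursive_compose[of "\<lambda>n. Some (f n)" g] assms by (simp add: computable_def)

lemma computable_pair [computable_intros]:
  assumes "computable f" "computable g"
  shows "computable (\<lambda>n. prod_encode (f n, g n))"
  using partial_recursive.pair[OF assms[unfolded computable_def]] by (simp add: computable_def)

text \<open>The pair of the two projections is the identity because \<open>prod_encode\<close> is
  surjective.\<close>

lemma computable_id [computable_intros]: "computable (\<lambda>n. n)"
  using partial_recursive.pair[OF partial_recursive.left partial_recursive.right]
  by (simp add: computable_def)

lemma computable_first [computable_intros]: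
  assumes "computable f" shows "computable (\<lambda>n. first (f n))"
  by (rule computable_compose[OF _ assms]) (simp add: computable_def partial_recursive.left)

lemma computable_second [computable_intros]:
  assumes "computable f" shows "computable (\<lambda>n. second (f n))"
  by (rule computable_compose[OF _ assms]) (simp add: computable_def partial_recursive.right)

lemma computable_Suc [computable_intros]:
  assumes "computable f" shows "computable (\<lambda>n. Suc (f n))"
  by (rule computable_compose[OF _ assms]) (simp add: computable_def partial_recursive.succ)

lemma computable_cong: "(\<And>n. f n = g n) \<Longrightarrow> computable g \<Longrightarrow> computable f"
  by presburger

lemma computable_const [computable_intros]: "computable (\<lambda>_. k)"
proof (induction k)
  case 0
  show ?case by (simp add: computable_def partial_recursive.zero)
qed (rule computable_Suc)

text \<open>The input is carried along beside the result of \<open>F\<close>, so that a total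
  \<open>G\<close> may use both. This is how the assumed algorithms, which may diverge on irrelevant
  inputs, are mostly embedded later.\<close>

lemma partial_recursive_map:
  assumes F: "partial_recursive F" and f: "computable f" and G: "computable G"
  shows "partial_recursive (\<lambda>n. map_option (\<lambda>b. G (prod_encode (n, b))) (F (f n)))"
proof -
  have "partial_recursive (\<lambda>n. Option.bind (Some n)
      (\<lambda>a. map_option (\<lambda>b. prod_encode (a, b)) (F (f n))))"
    by (rule partial_recursive.pair[OF computable_id[unfolded computable_def]
          partial_recursive_compose[OF F f]])
  from partial_recursive.comp[OF G[unfolded computable_def] this] show ?thesis
    by (rule back_subst[of partial_recursive])
      (auto simp: map_comp_def fun_eq_iff split: option.splits)
qed

text \<open>The schema \<open>prec\<close> holds one parameter fixed. The whole input is taken as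
  that parameter, and the recursion is then run on the pair of the input and
  \<open>h n\<close>.\<close>

lemma computable_rec [computable_intros]:
  assumes f: "computable f"
    and g: "computable (\<lambda>t. g (first t) (first (second t)) (second (second t)))"
    and h: "computable h"
  shows "computable (\<lambda>n. rec_nat (f n) (g n) (h n))"
proof -
  have rec: "prim_rec (\<lambda>n. Some (f n))
        (\<lambda>t. Some (g (first t) (first (second t)) (second (second t)))) a k
      = Some (rec_nat (f a) (g a) k)" for a k
    by (induction k) auto
  have "computable (\<lambda>n. rec_nat (f (first n)) (g (first n)) (second n))"
    using partial_recursive.prec[OF f[unfolded computable_def] g[unfolded computable_def]]
    by (simp add: computable_def rec)
  from computable_compose[OF this computable_pair[OF computable_id h]] show ?thesis
    by simp
qed

lemma computable_add [computable_intros]: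
  assumes "computable f" "computable g"
  shows "computable (\<lambda>n. f n + g n)"
proof -
  have "a + k = rec_nat a (\<lambda>_. Suc) k" for a k
    by (induction k) auto
  then show ?thesis
    by (rule computable_cong) (intro computable_intros assms)
qed

lemma computable_pred [computable_intros]:
  assumes "computable f"
  shows "computable (\<lambda>n. f n - 1)"
proof -
  have "k - 1 = rec_nat 0 (\<lambda>i _. i) k" for k :: nat
    by (cases k) auto
  then show ?thesis
    by (rule computable_cong) (intro computable_intros assms)
qed

lemma computable_diff [computable_intros]:
  assumes "computable f" "computable g"
  shows "computable (\<lambda>n. f n - g n)"
proof -
  have "a - k = rec_nat a (\<lambda>_ y. y - 1) k" for a k :: nat
    by (induction k) auto
  then show ?thesis
    by (rule computable_cong) (intro computable_intros assms)
qed

lemma computable_if_eq [computable_intros]: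
  assumes "computable f" "computable f'" "computable g" "computable h"
  shows "computable (\<lambda>n. if f n = f' n then g n else h n)"
proof -
  \<comment> \<open>The sum of both truncated differences vanishes exactly when the arguments agree,
    and a recursion whose step ignores its arguments separates zero from the successors.\<close>
  have "(if f n = f' n then g n else h n)
      = rec_nat (g n) (\<lambda>_ _. h n) ((f n - f' n) + (f' n - f n))" for n
    by (cases "(f n - f' n) + (f' n - f n)") auto
  moreover have "computable (\<lambda>t. h (first t))"
    by (rule computable_compose[OF assms(4)]) (intro computable_intros)
  then have "computable (\<lambda>n. rec_nat (g n) (\<lambda>_ _. h n) ((f n - f' n) + (f' n - f n)))"
    by (intro computable_intros assms)
  ultimately show ?thesis
    by (rule computable_cong)
qed

lemma computable_funpow [computable_intros]:
  assumes "computable f" "computable (\<lambda>t. g (first t) (second t))" "computable h"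
  shows "computable (\<lambda>n. (g n ^^ h n) (f n))"
proof -
  have "(g n ^^ k) x = rec_nat x (\<lambda>_. g n) k" for n k x
    by (induction k) auto
  then have eq: "(g n ^^ h n) (f n) = rec_nat (f n) (\<lambda>_. g n) (h n)" for n .
  have "computable (\<lambda>t. g (first t) (second (second t)))"
    using computable_compose[OF assms(2), of "\<lambda>t. prod_encode (first t, second (second t))"]
    by (simp add: computable_intros)
  then have "computable (\<lambda>n. rec_nat (f n) (\<lambda>_. g n) (h n))"
    by (intro computable_rec assms)
  then show ?thesis
    by (simp only: eq)
qed

section \<open>Lists as numbers\<close>

abbreviation cons_code :: "nat \<Rightarrow> nat \<Rightarrow> nat" where
  "cons_code x l \<equiv> Suc (prod_encode (x, l))"

abbreviation tl_code :: "nat \<Rightarrow> nat" where "tl_code l \<equiv> second (l - 1)"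

definition nth_code :: "nat \<Rightarrow> nat \<Rightarrow> nat" where
  "nth_code l i = first ((tl_code ^^ i) l - 1)"

lemma nth_code [simp]: "i < length xs \<Longrightarrow> nth_code (list_encode xs) i = xs ! i"
proof (induction xs arbitrary: i)
  case (Cons x xs)
  then show ?case by (cases i) (auto simp: nth_code_def funpow_Suc_right simp del: funpow.simps(2))
qed simp

lemma computable_nth_code [computable_intros]:
  assumes "computable f" "computable g"
  shows "computable (\<lambda>n. nth_code (f n) (g n))"
  unfolding nth_code_def by (intro computable_intros assms)

text \<open>The fold is an iteration on pairs of a remaining list and an accumulator. An empty
  remaining list makes \<open>step\<close> idle, so any computable upper bound on the length can
  serve as the number of iterations.\<close>

lemma computable_fold [computable_intros]:
  assumes f: "computable f"
    and g: "computable (\<lambda>t. g (first t) (first (second t)) (second (second t)))"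
    and a: "computable a"
  shows "computable (\<lambda>n. fold (g n) (list_decode (f n)) (a n))"
proof -
  define step where "step n s =
    (if first s = 0 then s
     else prod_encode (tl_code (first s), g n (first (first s - 1)) (second s)))" for n s
  have iter: "length xs \<le> k \<Longrightarrow>
      (step n ^^ k) (prod_encode (list_encode xs, y)) = prod_encode (0, fold (g n) xs y)"
    for n k xs y
  proof (induction k arbitrary: xs y)
    case (Suc k)
    then show ?case
      using Suc.IH[of "[]"] by (cases xs) (simp_all add: funpow_Suc_right step_def del: funpow.simps(2))
  qed simp
  \<comment> \<open>The code of a list is itself such a bound, since \<open>prod_encode\<close>
    dominates its second component and each \<open>cons_code\<close> adds one.\<close>
  have len: "length (list_decode l) \<le> l" for l
  proof (induction l rule: less_induct)
    case (less l)
    show ?case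
    proof (cases l)
      case (Suc k)
      obtain x y where xy: "prod_decode k = (x, y)" by fastforce
      then have "y \<le> k" by (metis le_prod_encode_2 prod_decode_inverse)
      with less[of y] Suc xy show ?thesis by simp
    qed simp
  qed
  have eq: "fold (g n) (list_decode (f n)) (a n) = second ((step n ^^ f n) (prod_encode (f n, a n)))"
    for n
    using iter[OF len[of "f n"], of n "a n"] by simp
  have "computable (\<lambda>t. g (first t) (first (first (second t) - 1)) (second (second t)))"
    using computable_compose[OF g, of "\<lambda>t. prod_encode (first t,
        prod_encode (first (first (second t) - 1), second (second t)))"]
    by (simp add: computable_intros)
  then have "computable (\<lambda>t. step (first t) (second t))"
    unfolding step_def by (intro computable_intros)
  then have "computable (\<lambda>n. second ((step n ^^ f n) (prod_encode (f n, a n))))"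
    by (intro computable_intros f a)
  then show ?thesis
    by (simp only: eq)
qed

text \<open>Together with \<open>length_code\<close> this passes between a number and the unary word
  that represents it as a condition.\<close>

definition replicate_code :: "nat \<Rightarrow> nat" where
  "replicate_code n = bits_code (replicate n True)"

lemma computable_replicate_code [computable_intros]:
  assumes "computable f" shows "computable (\<lambda>n. replicate_code (f n))"
proof -
  have "replicate_code k = rec_nat 0 (\<lambda>_. cons_code 1) k" for k
    by (induction k) (auto simp: replicate_code_def bits_code_def)
  then show ?thesis
    by (rule computable_cong) (intro computable_intros assms)
qed

definition length_code :: "nat \<Rightarrow> nat" where
  "length_code l = fold (\<lambda>_. Suc) (list_decode l) 0"

lemma length_bits_code [simp]: "length_code (bits_code y) = length y"
proof -
  have "fold (\<lambda>_. Suc) xs k = length xs + k" for xs :: "nat list" and k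
    by (induction xs arbitrary: k) auto
  then show ?thesis by (simp add: length_code_def bits_code_def)
qed

lemma computable_length_code [computable_intros]:
  assumes "computable f" shows "computable (\<lambda>n. length_code (f n))"
  unfolding length_code_def by (intro computable_intros assms)

definition bits_decode :: "nat \<Rightarrow> bits" where
  "bits_decode n = map (\<lambda>x. x \<noteq> 0) (list_decode n)"

lemma bits_decode_bits_code [simp]: "bits_decode (bits_code x) = x"
  by (simp add: bits_decode_def bits_code_def comp_def)

lemma inj_bits_code: "inj bits_code"
  by (rule inj_on_inverseI[of _ bits_decode]) simp

lemma fold_cons_code:
  "fold (\<lambda>x. cons_code (f x)) xs (list_encode ys) = list_encode (rev (map f xs) @ ys)"
  by (induction xs arbitrary: ys) (auto simp flip: list_encode.simps)

text \<open>Replacing nonzero entries by 1 turns any number into the code of a word. A fold with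
  \<open>cons_code\<close> reverses its list, so a second fold restores the order.\<close>

lemma computable_bits_code_bits_decode [computable_intros]:
  assumes "computable f" shows "computable (\<lambda>n. bits_code (bits_decode (f n)))"
proof -
  define sg where "sg x = (if x = 0 then 0 else 1 :: nat)" for x :: nat
  have "bits_code (bits_decode k) =
      fold cons_code (list_decode (fold (\<lambda>x. cons_code (sg x)) (list_decode k) 0)) 0" for k
  proof -
    have "sg = of_bool \<circ> (\<lambda>x. x \<noteq> 0)"
      by (simp add: sg_def fun_eq_iff)
    then have "bits_code (bits_decode k) = list_encode (map sg (list_decode k))"
      by (simp only: bits_code_def bits_decode_def map_map)
    then show ?thesis
      using fold_cons_code[of sg "list_decode k" "[]"]
        fold_cons_code[of "\<lambda>x. x" "rev (map sg (list_decode k))" "[]"]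
      by (simp add: rev_map)
  qed
  then show ?thesis
    unfolding sg_def by (rule computable_cong) (intro computable_intros assms)
qed

text \<open>The result lists \<open>(A - C) \<union> D\<close> if the arguments list \<open>A\<close>, \<open>C\<close>, \<open>D\<close>; the order is irrelevant.\<close>

definition exchange_code :: "nat \<Rightarrow> nat \<Rightarrow> nat \<Rightarrow> nat" where
  "exchange_code a c d =
     fold (\<lambda>x l. if fold (\<lambda>y b. if y = x then 1 else b) (list_decode c) 0 = (0::nat)
                 then cons_code x l else l) (list_decode a) d"

lemma exchange_code:
  "exchange_code (list_encode xs) (list_encode ys) (list_encode zs)
     = list_encode (rev (filter (\<lambda>x. x \<notin> set ys) xs) @ zs)"
proof -
  \<comment> \<open>The inner fold raises a flag once x is met; the initial flag is arbitrary for
    the sake of the induction.\<close>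
  have mem: "fold (\<lambda>y b. if y = x then 1 else b) ys b = (0::nat) \<longleftrightarrow> x \<notin> set ys \<and> b = 0"
    for x b and ys :: "nat list"
    by (induction ys arbitrary: b) auto
  show ?thesis
    unfolding exchange_code_def list_encode_inverse mem
    by (induction xs arbitrary: zs) (auto simp flip: list_encode.simps)
qed

lemma computable_exchange_code [computable_intros]:
  assumes "computable f" "computable g" "computable h"
  shows "computable (\<lambda>n. exchange_code (f n) (g n) (h n))"
proof -
  have "computable (\<lambda>t. g (first t))"
    by (rule computable_compose[OF assms(2)]) (intro computable_intros)
  moreover have "computable (\<lambda>t. g (first (first t)))"
    by (rule computable_compose[OF assms(2)]) (intro computable_intros)
  ultimately show ?thesis
    unfolding exchange_code_def by (intro computable_intros assms)
qed

section \<open>Transforming the condition\<close>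

text \<open>\<open>KC\<close> is a \<open>LEAST\<close>, which carries no information when no
  program exists. Here existence comes together with the bound, and the bound is real so that
  constants and logarithms combine freely.\<close>

definition produces :: "machine \<Rightarrow> bits \<Rightarrow> bits \<Rightarrow> real \<Rightarrow> bool" where
  "produces U x y k \<longleftrightarrow> (\<exists>p. U p y = Some x \<and> real (length p) \<le> k)"

lemma produces_mono: "produces U x y k \<Longrightarrow> k \<le> l \<Longrightarrow> produces U x y l"
  unfolding produces_def by (meson order_trans)

lemma KC_le:
  assumes "produces U x y k" shows "real (KC U x y) \<le> k"
proof -
  from assms obtain p where p: "U p y = Some x" "real (length p) \<le> k"
    by (auto simp: produces_def)
  then have "KC U x y \<le> length p"
    unfolding KC_def by (intro Least_le) auto
  with p(2) show ?thesis by linarith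
qed

lemma produces_KC:
  assumes "produces U x y k" shows "produces U x y (real (KC U x y))"
proof -
  from assms have "\<exists>n p. length p = n \<and> U p y = Some x"
    by (auto simp: produces_def)
  from LeastI_ex[OF this] show ?thesis
    by (auto simp: produces_def KC_def)
qed

lemma optimal_prefix_machine_overhead:
  assumes "optimal_prefix_machine U" "prefix_machine W"
  shows "\<exists>c. \<forall>p y x. W p y = Some x \<longrightarrow> (\<exists>p'. U p' y = Some x \<and> length p' \<le> length p + c)"
  using assms unfolding optimal_prefix_machine_def by blast

text \<open>Prefix-freeness is required for each condition separately. For the condition y the
  halting programs are those of \<open>U\<close> for \<open>\<phi> y\<close>, or none, so it is
  inherited.\<close>

lemma prefix_machine_precompose:
  assumes U: "prefix_machine U" and \<Phi>: "partial_recursive \<Phi>"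
    and \<phi>: "\<And>y. \<Phi> (bits_code y) = map_option bits_code (\<phi> y)"
  shows "prefix_machine (\<lambda>p y. Option.bind (\<phi> y) (U p))"
proof -
  from U obtain F where F: "partial_recursive F"
    and FU: "\<And>p y. F (prod_encode (bits_code p, bits_code y)) = map_option bits_code (U p y)"
    and pf: "\<And>y p p'. U p y \<noteq> None \<Longrightarrow> U p' y \<noteq> None \<Longrightarrow> prefix p p' \<Longrightarrow> p = p'"
    unfolding prefix_machine_def by blast
  let ?G = "\<lambda>n. Option.bind (Some (first n)) (\<lambda>a. map_option (\<lambda>b. prod_encode (a, b)) (\<Phi> (second n)))"
  have "partial_recursive (F \<circ>\<^sub>m ?G)"
    by (intro partial_recursive.comp F partial_recursive.pair partial_recursive.left
        partial_recursive_compose[OF \<Phi>] computable_intros)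
  moreover have "(F \<circ>\<^sub>m ?G) (prod_encode (bits_code p, bits_code y))
      = map_option bits_code (Option.bind (\<phi> y) (U p))" for p y
    by (cases "\<phi> y") (simp_all add: map_comp_def \<phi> FU)
  moreover have "Option.bind (\<phi> y) (U p) \<noteq> None \<Longrightarrow> Option.bind (\<phi> y) (U p') \<noteq> None \<Longrightarrow>
      prefix p p' \<Longrightarrow> p = p'" for p p' y
    using pf[of p "the (\<phi> y)" p'] by (cases "\<phi> y") simp_all
  ultimately show ?thesis
    unfolding prefix_machine_def by blast
qed

lemma prefix_machine_condition: "prefix_machine (\<lambda>p y. if p = [] then Some y else None)"
proof -
  \<comment> \<open>The searched function ignores the search variable. The search therefore stops at
    0 if the program has code 0, that is, if it is empty, and diverges otherwise.\<close>
  let ?D = "minimise (\<lambda>t. Some (first (first t)))"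
  let ?F = "\<lambda>n. map_option (\<lambda>b. second (first (prod_encode (n, b)))) (?D n)"
  have F: "partial_recursive ?F"
    by (intro partial_recursive_map[where G = "\<lambda>t. second (first t)"] partial_recursive.mu
        computable_intros) (fold computable_def, intro computable_intros)
  have D: "?D n = (if first n = 0 then Some 0 else None)" for n
    by (auto simp: minimise_def intro: Least_equality)
  have F_eq: "?F (prod_encode (bits_code p, bits_code y))
      = map_option bits_code (if p = [] then Some y else None)" for p y
    unfolding D by (cases p) (auto simp: bits_code_def)
  then show ?thesis
    unfolding prefix_machine_def using F by (intro conjI exI[of _ ?F] allI) (auto split: if_splits)
qed

text \<open>The numbers \<open>n\<close> serve as intermediate conditions, written in unary: the length of a condition
  does not matter.\<close>

abbreviation unary :: "nat \<Rightarrow> bits" where "unary n \<equiv> replicate n True"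

section \<open>Effect of changes of the condition under an optimal machine\<close>

context
  fixes U :: machine
  assumes U: "optimal_prefix_machine U"
begin

lemma produces_precompose:
  assumes "partial_recursive \<Phi>" "\<And>y. \<Phi> (bits_code y) = map_option bits_code (\<phi> y)"
  shows "\<exists>c. \<forall>x y z k. \<phi> y = Some z \<longrightarrow> produces U x z k \<longrightarrow> produces U x y (k + c)"
proof -
  have "prefix_machine U" using U by (simp add: optimal_prefix_machine_def)
  from optimal_prefix_machine_overhead[OF U prefix_machine_precompose[OF this assms]] obtain c
    where c: "\<forall>p y x. Option.bind (\<phi> y) (U p) = Some x \<longrightarrow>
          (\<exists>p'. U p' y = Some x \<and> length p' \<le> length p + c)" ..
  have "produces U x y (k + real c)" if "\<phi> y = Some z" "produces U x z k" for x y z k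
  proof -
    from that obtain p where p: "Option.bind (\<phi> y) (U p) = Some x" "real (length p) \<le> k"
      by (auto simp: produces_def)
    from c p(1) obtain p' where "U p' y = Some x" "length p' \<le> length p + c"
      by blast
    with p(2) show ?thesis
      unfolding produces_def by (intro exI[of _ p']) auto
  qed
  then show ?thesis by blast
qed

text \<open>This ends a chain of changes: once the condition is the desired output, a program of
  constant length remains.\<close>

lemma produces_self: "\<exists>c. \<forall>y. produces U y y c"
proof -
  from optimal_prefix_machine_overhead[OF U prefix_machine_condition] obtain c
    where c: "\<forall>(p :: bits) y x. (if p = [] then Some y else None) = Some x \<longrightarrow>
      (\<exists>p'. U p' y = Some x \<and> length p' \<le> length p + c)" ..
  have "produces U y y (real c)" for y
    using c[rule_format, of "[]" y y] by (auto simp: produces_def)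
  then show ?thesis by blast
qed

lemma produces_to_unary:
  "\<exists>c. \<forall>x y k. produces U x (unary (bits_code y)) k \<longrightarrow> produces U x y (k + c)"
proof -
  have "computable (\<lambda>n. replicate_code n)" by (intro computable_intros)
  from produces_precompose[OF this[unfolded computable_def], of "\<lambda>y. Some (unary (bits_code y))"]
  show ?thesis by (simp add: replicate_code_def)
qed

lemma produces_from_unary:
  "\<exists>c. \<forall>x y k. produces U x y k \<longrightarrow> produces U x (unary (bits_code y)) (k + c)"
proof -
  have "computable (\<lambda>n. bits_code (bits_decode (length_code n)))" by (intro computable_intros)
  from produces_precompose[OF this[unfolded computable_def],
      of "\<lambda>y. Some (bits_decode (length y))"]
  obtain c where "produces U x (bits_decode (length y)) k \<Longrightarrow> produces U x y (k + c)" for x y k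
    by auto
  from this[of _ "unary (bits_code _)"] show ?thesis by auto
qed

text \<open>The change of condition reads the length of the condition, applies \<open>F\<close> and
  writes the value in unary. Note the direction: a computation from s to t carries a bound for t
  back to a bound for s.\<close>

lemma produces_step:
  assumes "partial_recursive F"
  shows "\<exists>c\<ge>0. \<forall>x s t k. F s = Some t \<longrightarrow> produces U x (unary t) k \<longrightarrow> produces U x (unary s) (k + c)"
proof -
  have "partial_recursive (\<lambda>n. map_option (\<lambda>b. replicate_code (second (prod_encode (n, b))))
      (F (length_code n)))"
    by (intro partial_recursive_map[where G = "\<lambda>t. replicate_code (second t)"] assms
        computable_intros)
  from produces_precompose[OF this, of "\<lambda>y. map_option unary (F (length y))"]
  obtain c where c: "\<And>x y z k. map_option unary (F (length y)) = Some z \<Longrightarrow> produces U x z k \<Longrightarrow>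
      produces U x y (k + c)"
    by (simp add: option.map_comp comp_def replicate_code_def) blast
  \<comment> \<open>A nonnegative constant is secured because it will be multiplied by numbers of
    digits and of steps.\<close>
  have "produces U x (unary s) (k + max 0 c)"
    if "F s = Some t" "produces U x (unary t) k" for x s t k
    using c[of "unary s" "unary t" x k] that by (auto intro: produces_mono)
  then show ?thesis by (meson max.cobounded1)
qed

lemma produces_step_computable:
  assumes "computable f"
  shows "\<exists>c\<ge>0. \<forall>x s k. produces U x (unary (f s)) k \<longrightarrow> produces U x (unary s) (k + c)"
  using produces_step[OF assms[unfolded computable_def]] by simp

text \<open>Horner's scheme: j arises from 0 by the maps from i to 2i and to 2i + 1, one for each
  binary digit. The induction removes the last digit, and 0 has no digits in the sense of
  \<open>floorlog\<close>.\<close>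

lemma produces_number:
  "\<exists>c\<ge>0. \<forall>x a j k. produces U x (unary (prod_encode (a, j))) k \<longrightarrow>
     produces U x (unary (prod_encode (a, 0))) (k + c * real (floorlog 2 j))"
proof -
  have "computable (\<lambda>t. prod_encode (first t, second t + second t))"
    by (intro computable_intros)
  from produces_step_computable[OF this] obtain c0 where c0: "c0 \<ge> 0"
    "\<And>x a i k. produces U x (unary (prod_encode (a, 2 * i))) k \<Longrightarrow>
       produces U x (unary (prod_encode (a, i))) (k + c0)"
    by (metis fst_conv snd_conv prod_encode_inverse mult_2)
  have "computable (\<lambda>t. prod_encode (first t, Suc (second t + second t)))"
    by (intro computable_intros)
  from produces_step_computable[OF this] obtain c1 where c1: "c1 \<ge> 0"
    "\<And>x a i k. produces U x (unary (prod_encode (a, Suc (2 * i)))) k \<Longrightarrow>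
       produces U x (unary (prod_encode (a, i))) (k + c1)"
    by (metis fst_conv snd_conv prod_encode_inverse mult_2)
  have "produces U x (unary (prod_encode (a, j))) k \<Longrightarrow>
     produces U x (unary (prod_encode (a, 0))) (k + max c0 c1 * real (floorlog 2 j))" for x a j k
  proof (induction j arbitrary: k rule: less_induct)
    case (less j)
    show ?case
    proof (cases "j = 0")
      case True
      with less.prems show ?thesis by (simp add: floorlog_def)
    next
      case False
      then have fl: "floorlog 2 j = Suc (floorlog 2 (j div 2))"
        by (subst compute_floorlog) simp
      have "j = 2 * (j div 2) \<or> j = Suc (2 * (j div 2))" by presburger
      then have "produces U x (unary (prod_encode (a, j div 2))) (k + max c0 c1)"
        using c0(2)[of x a "j div 2" k] c1(2)[of x a "j div 2" k] less.prems
        by (metis produces_mono add_left_mono max.cobounded1 max.cobounded2)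
      from less.IH[OF _ this] False fl show ?thesis
        by (simp add: algebra_simps)
    qed
  qed
  with c0(1) show ?thesis by (meson max.coboundedI1)
qed

text \<open>Each entry is built in the second slot next to the state; then \<open>g\<close> absorbs
  it and the slot returns to 0, ready for the next entry.\<close>

lemma produces_fold:
  assumes g: "computable (\<lambda>t. g (second t) (first t))"
  shows "\<exists>c\<ge>0. \<forall>x a is k. produces U x (unary (prod_encode (fold g is a, 0))) k \<longrightarrow>
     produces U x (unary (prod_encode (a, 0))) (k + c * real (sum_list (map index_length is)))"
proof -
  obtain c0 where c0: "c0 \<ge> 0"
    "\<And>x a j k. produces U x (unary (prod_encode (a, j))) k \<Longrightarrow>
      produces U x (unary (prod_encode (a, 0))) (k + c0 * real (floorlog 2 j))"
    using produces_number by blast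
  have "computable (\<lambda>t. prod_encode (g (second t) (first t), 0))"
    by (intro computable_intros g)
  from produces_step_computable[OF this] obtain c1 where c1: "c1 \<ge> 0"
    "\<And>x a j k. produces U x (unary (prod_encode (g j a, 0))) k \<Longrightarrow>
       produces U x (unary (prod_encode (a, j))) (k + c1)"
    by (metis fst_conv snd_conv prod_encode_inverse)
  have "produces U x (unary (prod_encode (fold g is a, 0))) k \<Longrightarrow>
     produces U x (unary (prod_encode (a, 0))) (k + (c0 + c1) * real (sum_list (map index_length is)))"
    for x a "is" k
  proof (induction "is" arbitrary: a)
    case (Cons j js)
    \<comment> \<open>The cost \<open>c1\<close> of absorbing an entry is charged to a digit. This
      is possible even for the entry 0, because \<open>index_length\<close> is at least 1.\<close>
    have "c0 * real (floorlog 2 j) \<le> c0 * real (index_length j)" "c1 * 1 \<le> c1 * real (index_length j)"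
      using c0(1) c1(1) by (intro mult_left_mono; simp add: index_length_def)+
    then have "c0 * real (floorlog 2 j) + c1 \<le> (c0 + c1) * real (index_length j)"
      by (simp add: distrib_right)
    moreover from Cons have "produces U x (unary (prod_encode (g j a, 0)))
        (k + (c0 + c1) * real (sum_list (map index_length js)))"
      by simp
    from c0(2)[OF c1(2)[OF this]] have "produces U x (unary (prod_encode (a, 0)))
        (k + (c0 + c1) * real (sum_list (map index_length js)) + c1 + c0 * real (floorlog 2 j))" .
    ultimately show ?case
      by (elim produces_mono) (simp add: algebra_simps)
  qed simp
  with c0(1) c1(1) show ?thesis by (meson add_nonneg_nonneg)
qed

section \<open>Replay of a trace inside the condition\<close>

lemma index_length_mono: "i \<le> j \<Longrightarrow> index_length i \<le> index_length j"
  using floorlog_mono[of i j 2] unfolding index_length_def by simp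

text \<open>Two reversals: the list is reversed onto the empty list, and the result is reversed onto
  the singleton of x.\<close>

definition snoc_code :: "nat \<Rightarrow> nat \<Rightarrow> nat" where
  "snoc_code l x = fold cons_code (list_decode (fold cons_code (list_decode l) 0)) (cons_code x 0)"

lemma snoc_code [simp]: "snoc_code (list_encode xs) x = list_encode (xs @ [x])"
  using fold_cons_code[of "\<lambda>x. x" xs "[]"] fold_cons_code[of "\<lambda>x. x" "rev xs" "[x]"]
  by (simp add: snoc_code_def)

lemma computable_snoc_code [computable_intros]:
  assumes "computable f" "computable g"
  shows "computable (\<lambda>n. snoc_code (f n) (g n))"
  unfolding snoc_code_def by (intro computable_intros assms)

abbreviation list_code :: "('s, 'f, 'r) encoding \<Rightarrow> ('s, 'f, 'r) fm list \<Rightarrow> nat" where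
  "list_code enc \<phi>s \<equiv> list_encode (map (bits_code \<circ> enc) \<phi>s)"

text \<open>The pool has two companions: the vector of premises collected for the next inference,
  here empty with code 0, and a number under construction.\<close>

abbreviation pool_state :: "('s, 'f, 'r) encoding \<Rightarrow> ('s, 'f, 'r) fm list \<Rightarrow> nat \<Rightarrow> nat" where
  "pool_state enc pool i \<equiv> prod_encode (prod_encode (list_code enc pool, 0), i)"

text \<open>The indices of the premises and the rule identifier are supplied digit by digit. Since
  the arity and the number of rules are bounded, the cost is of the order of the digits of one index
  into the pool.\<close>

lemma produces_inference:
  fixes S :: "('s, 'f, 'r) signature"
  assumes "effective_proof_system S enc rules"
  shows "\<exists>c\<ge>0. \<forall>x pool r is \<phi> k. r < length rules \<longrightarrow> (\<forall>i\<in>set is. i < length pool) \<longrightarrow>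
     (\<forall>p\<in>set pool. wf_fm S p) \<longrightarrow> (rules ! r) (map ((!) pool) is) = Some \<phi> \<longrightarrow>
     produces U x (unary (pool_state enc (pool @ [\<phi>]) 0)) k \<longrightarrow>
     produces U x (unary (pool_state enc pool 0)) (k + c * real (index_length (length pool)))"
proof -
  from assms have
    "\<exists>F. partial_recursive F \<and> (\<forall>r<length rules. \<forall>ps. (\<forall>p\<in>set ps. wf_fm S p) \<longrightarrow>
       F (prod_encode (r, list_code enc ps)) =
         Some (case (rules ! r) ps of None \<Rightarrow> 0 | Some c \<Rightarrow> Suc (bits_code (enc c))))"
    and "\<exists>a. \<forall>R\<in>set rules. \<forall>ps c. R ps = Some c \<longrightarrow> length ps \<le> a"
    unfolding effective_proof_system_def by simp_all
  then obtain F a where F: "partial_recursive F"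
    and F_eq: "\<forall>r<length rules. \<forall>ps. (\<forall>p\<in>set ps. wf_fm S p) \<longrightarrow>
       F (prod_encode (r, list_code enc ps)) =
         Some (case (rules ! r) ps of None \<Rightarrow> 0 | Some c \<Rightarrow> Suc (bits_code (enc c)))"
    and arity: "\<forall>R\<in>set rules. \<forall>ps c. R ps = Some c \<longrightarrow> length ps \<le> a"
    by (elim exE conjE)
  \<comment> \<open>The formula looked up is prepended to the vector, so the indices have to be
    supplied in reverse order.\<close>
  let ?g = "\<lambda>i s. prod_encode (first s, cons_code (nth_code (first s) i) (second s))"
  have "computable (\<lambda>t. ?g (second t) (first t))" by (intro computable_intros)
  from produces_fold[OF this] obtain c1 where c1: "c1 \<ge> 0"
    "\<And>x a is k. produces U x (unary (prod_encode (fold ?g is a, 0))) k \<Longrightarrow>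
      produces U x (unary (prod_encode (a, 0))) (k + c1 * real (sum_list (map index_length is)))"
    by blast
  have fold_g: "fold ?g is (prod_encode (list_encode l, list_encode v))
      = prod_encode (list_encode l, list_encode (map ((!) l) (rev is) @ v))"
    if "\<forall>i\<in>set is. i < length l" for l v "is"
    using that by (induction "is" arbitrary: v) (auto simp flip: list_encode.simps)
  obtain c2 where c2: "c2 \<ge> 0"
    "\<And>x a j k. produces U x (unary (prod_encode (a, j))) k \<Longrightarrow>
      produces U x (unary (prod_encode (a, 0))) (k + c2 * real (floorlog 2 j))"
    using produces_number by blast
  \<comment> \<open>From pool, premises and rule identifier, \<open>?f\<close> forms the input of
    \<open>F\<close>. In \<open>?G\<close>, subtracting 1 removes the \<open>Suc\<close> that marks
    an applicable rule; the conclusion joins the pool and both other slots are cleared.\<close>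
  let ?f = "\<lambda>t. prod_encode (second t, second (first t))"
  let ?G = "\<lambda>t. prod_encode (prod_encode
      (snoc_code (first (first (first t))) (second t - 1), 0), 0)"
  have "partial_recursive (\<lambda>t. map_option (\<lambda>b. ?G (prod_encode (t, b))) (F (?f t)))"
    by (rule partial_recursive_map[OF F]) (intro computable_intros)+
  from produces_step[OF this] obtain c3 where c3: "c3 \<ge> 0"
    "\<And>x s t k. map_option (\<lambda>b. ?G (prod_encode (s, b))) (F (?f s)) = Some t \<Longrightarrow>
       produces U x (unary t) k \<Longrightarrow> produces U x (unary s) (k + c3)"
    by blast
  \<comment> \<open>One application of the rule, the digits of its identifier, and at most
    \<open>a\<close> indices; the first two are constant and are absorbed since
    \<open>index_length\<close> is at least 1.\<close>
  define c where "c = c3 + c2 * real (floorlog 2 (length rules)) + c1 * real a"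
  have "produces U x (unary (pool_state enc pool 0)) (k + c * real (index_length (length pool)))"
    if r: "r < length rules" and "is": "\<forall>i\<in>set is. i < length pool"
      and wf: "\<forall>p\<in>set pool. wf_fm S p" and \<phi>: "(rules ! r) (map ((!) pool) is) = Some \<phi>"
      and k: "produces U x (unary (pool_state enc (pool @ [\<phi>]) 0)) k"
    for x pool r "is" \<phi> k
  proof -
    let ?ps = "map ((!) pool) is" and ?L = "real (index_length (length pool))"
    let ?s = "prod_encode (list_code enc pool, list_code enc ?ps)"
    have "\<forall>p\<in>set ?ps. wf_fm S p"
      using wf "is" by auto
    with F_eq r \<phi> have "F (prod_encode (r, list_code enc ?ps)) = Some (Suc (bits_code (enc \<phi>)))"
      by (metis option.case(2))
    then have "produces U x (unary (prod_encode (?s, r))) (k + c3)"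
      using k by (intro c3(2)) auto
    then have "produces U x (unary (prod_encode (?s, 0))) (k + c3 + c2 * real (floorlog 2 r))"
      by (rule c2(2))
    moreover have "fold ?g (rev is) (prod_encode (list_code enc pool, 0)) = ?s"
      using fold_g[of "rev is" "map (bits_code \<circ> enc) pool" "[]"] "is"
      by (simp add: comp_def cong: map_cong)
    ultimately have "produces U x (unary (pool_state enc pool 0))
        (k + c3 + c2 * real (floorlog 2 r) + c1 * real (sum_list (map index_length (rev is))))"
      using c1(2)[of x "rev is"] by simp
    moreover have "real (floorlog 2 r) \<le> real (floorlog 2 (length rules)) * ?L"
    proof -
      have "real (floorlog 2 r) * 1 \<le> real (floorlog 2 (length rules)) * ?L"
        using r by (intro mult_mono) (auto simp: floorlog_mono index_length_def)
      then show ?thesis by simp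
    qed
    then have "c2 * real (floorlog 2 r) \<le> c2 * real (floorlog 2 (length rules)) * ?L"
      using c2(1) by (simp add: mult.assoc mult_left_mono)
    moreover have "real (sum_list (map index_length (rev is))) \<le> real a * ?L"
    proof -
      have "sum_list (map index_length (rev is)) \<le> length is * index_length (length pool)"
        using sum_list_mono[of "is" index_length "\<lambda>_. index_length (length pool)",
            OF index_length_mono[OF less_imp_le]] "is"
        by (simp add: sum_list_triv flip: rev_map)
      also have "length is \<le> a"
        using arity[rule_format, OF nth_mem[OF r] \<phi>] by simp
      finally show ?thesis
        by (simp flip: of_nat_mult)
    qed
    then have "c1 * real (sum_list (map index_length (rev is))) \<le> c1 * real a * ?L"
      using c1(1) by (simp add: mult.assoc mult_left_mono)
    moreover have "c3 * 1 \<le> c3 * ?L"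
      using c3(1) by (intro mult_left_mono) (auto simp: index_length_def)
    ultimately show ?thesis
      by (elim produces_mono) (simp add: c_def algebra_simps)
  qed
  moreover have "c \<ge> 0"
    using c1(1) c2(1) c3(1) by (simp add: c_def)
  ultimately show ?thesis by blast
qed

text \<open>Every index points into a pool no longer than the final one, so each step is charged the
  digits of the final length. Conclusions stay well-formed, as the algorithm for the rules is
  specified only on well-formed premises.\<close>

lemma produces_replay:
  fixes S :: "('s, 'f, 'r) signature"
  assumes system: "effective_proof_system S enc rules"
  shows "\<exists>c\<ge>0. \<forall>x pool steps pool' k. replay rules pool steps = Some pool' \<longrightarrow>
     (\<forall>p\<in>set pool. wf_fm S p) \<longrightarrow> produces U x (unary (pool_state enc pool' 0)) k \<longrightarrow>
     produces U x (unary (pool_state enc pool 0))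
       (k + c * real (length steps) * real (index_length (length pool + length steps)))"
proof -
  obtain c where c: "c \<ge> 0"
    "\<And>x pool r is \<phi> k. r < length rules \<Longrightarrow> \<forall>i\<in>set is. i < length pool \<Longrightarrow>
     \<forall>p\<in>set pool. wf_fm S p \<Longrightarrow> (rules ! r) (map ((!) pool) is) = Some \<phi> \<Longrightarrow>
     produces U x (unary (pool_state enc (pool @ [\<phi>]) 0)) k \<Longrightarrow>
     produces U x (unary (pool_state enc pool 0)) (k + c * real (index_length (length pool)))"
    using produces_inference[OF system] by blast
  have "produces U x (unary (pool_state enc pool 0))
       (k + c * real (length steps) * real (index_length (length pool + length steps)))"
    if "replay rules pool steps = Some pool'" "\<forall>p\<in>set pool. wf_fm S p"
      "produces U x (unary (pool_state enc pool' 0)) k"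
    for x pool steps pool' k
    using that
  proof (induction steps arbitrary: pool)
    case (Cons s steps)
    obtain r "is" where s: "s = (r, is)" by fastforce
    with Cons.prems(1) obtain \<phi> where r: "r < length rules" and "is": "\<forall>i\<in>set is. i < length pool"
      and \<phi>: "(rules ! r) (map ((!) pool) is) = Some \<phi>"
      and steps: "replay rules (pool @ [\<phi>]) steps = Some pool'"
      by (auto split: if_splits option.splits)
    have "wf_fm S \<phi>"
      using system nth_mem[OF r] \<phi> Cons.prems(2) "is"
      unfolding effective_proof_system_def by force
    with Cons.prems(2) have "\<forall>p\<in>set (pool @ [\<phi>]). wf_fm S p" by simp
    note c(2)[OF r "is" Cons.prems(2) \<phi> Cons.IH[OF steps this Cons.prems(3)]]
    moreover have "c * real (index_length (length pool)) \<le> c * real (index_length (length pool + length (s # steps)))"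
      using c(1) by (intro mult_left_mono) (simp_all add: index_length_mono)
    ultimately show ?case
      by (elim produces_mono) (simp add: algebra_simps)
  qed simp
  with c(1) show ?thesis by blast
qed

lemma length_replay: "replay rules pool steps = Some pool' \<Longrightarrow> length pool' = length pool + length steps"
  by (induction rules pool steps rule: replay.induct) (auto split: if_splits option.splits)

text \<open>The condition runs from the code of B through its listing and the replay to the formula
  at the output index. The \<open>Suc\<close> pays for this index and for the fixed conversions,
  which are due even for an empty trace.\<close>

lemma produces_derivation:
  fixes S :: "('s, 'f, 'r) signature"
  assumes system: "effective_proof_system S enc rules"
    and ambient: "effective_ambient_set S enc SO"
    and bases: "canonical_base_coding enc SO blist bcode"
  shows "\<exists>c\<ge>0. \<forall>B q \<pi>. premise_base SO B \<longrightarrow> derives rules blist \<pi> B q \<longrightarrow>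
     produces U (enc q) (bcode B)
       (c * real (Suc (length (fst \<pi>))) * real (index_length (card B + length (fst \<pi>))))"
proof -
  obtain L where L: "partial_recursive L"
    "\<And>B. premise_base SO B \<Longrightarrow> L (bits_code (bcode B)) = Some (list_code enc (blist B))"
    using bases unfolding canonical_base_coding_def by blast
  obtain c1 where c1: "\<And>x y k. produces U x (unary (bits_code y)) k \<Longrightarrow> produces U x y (k + c1)"
    using produces_to_unary by blast
  have "partial_recursive (\<lambda>n. map_option (\<lambda>b. prod_encode (prod_encode
      (second (prod_encode (n, b)), 0), 0)) (L n))"
    by (rule partial_recursive_map[OF L(1),
          where G = "\<lambda>t. prod_encode (prod_encode (second t, 0), 0)"]) (intro computable_intros)+
  from produces_step[OF this] obtain c2 where
    c2: "\<And>x s t k. map_option (\<lambda>b. prod_encode (prod_encode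
      (second (prod_encode (s, b)), 0), 0)) (L s) = Some t \<Longrightarrow>
       produces U x (unary t) k \<Longrightarrow> produces U x (unary s) (k + c2)"
    by blast
  obtain c3 where c3: "c3 \<ge> 0"
    "\<And>x pool steps pool' k. replay rules pool steps = Some pool' \<Longrightarrow>
     \<forall>p\<in>set pool. wf_fm S p \<Longrightarrow> produces U x (unary (pool_state enc pool' 0)) k \<Longrightarrow>
     produces U x (unary (pool_state enc pool 0))
       (k + c3 * real (length steps) * real (index_length (length pool + length steps)))"
    using produces_replay[OF system] by blast
  obtain c4 where c4: "c4 \<ge> 0"
    "\<And>x a j k. produces U x (unary (prod_encode (a, j))) k \<Longrightarrow>
      produces U x (unary (prod_encode (a, 0))) (k + c4 * real (floorlog 2 j))"
    using produces_number by blast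
  have "computable (\<lambda>t. nth_code (first (first t)) (second t))"
    by (intro computable_intros)
  from produces_step_computable[OF this] obtain c5 where
    c5: "\<And>x s k. produces U x (unary (nth_code (first (first s)) (second s))) k \<Longrightarrow>
       produces U x (unary s) (k + c5)"
    by blast
  obtain c6 where c6: "\<And>x y k. produces U x y k \<Longrightarrow> produces U x (unary (bits_code y)) (k + c6)"
    using produces_from_unary by blast
  obtain c7 where c7: "\<And>y. produces U y y c7"
    using produces_self by blast
  define d where "d = max 0 (c7 + c6 + c5 + c2 + c1)"
  have "produces U (enc q) (bcode B) ((d + c3 + c4) * real (Suc (length (fst \<pi>))) *
      real (index_length (card B + length (fst \<pi>))))"
    if B: "premise_base SO B" and \<pi>: "derives rules blist \<pi> B q" for B q \<pi>
  proof -
    let ?n = "real (length (fst \<pi>))" and ?L = "real (index_length (card B + length (fst \<pi>)))"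
    from \<pi> obtain pool where pool: "replay rules (blist B) (fst \<pi>) = Some pool"
      "snd \<pi> < length pool" "pool ! snd \<pi> = q"
      by (auto simp: derives_def)
    have blist: "set (blist B) = B" "length (blist B) = card B"
      using bases B distinct_card unfolding canonical_base_coding_def by force+
    have wf: "\<forall>p\<in>set (blist B). wf_fm S p"
      using blist B ambient unfolding premise_base_def effective_ambient_set_def by auto
    \<comment> \<open>The chain is assembled from its end, starting with the output itself and going
      back to the code of the base.\<close>
    have "produces U (enc q) (unary (pool_state enc pool (snd \<pi>))) (c7 + c6 + c5)"
      using c5[OF _, of "enc q" "pool_state enc pool (snd \<pi>)"] c6[OF c7, of "enc q"] pool(2,3)
      by simp
    from c3(2)[OF pool(1) wf c4(2)[OF this]]
    have "produces U (enc q) (unary (pool_state enc (blist B) 0))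
       (c7 + c6 + c5 + c4 * real (floorlog 2 (snd \<pi>)) + c3 * ?n * ?L)"
      by (simp add: blist)
    then have "produces U (enc q) (unary (bits_code (bcode B)))
       (c7 + c6 + c5 + c4 * real (floorlog 2 (snd \<pi>)) + c3 * ?n * ?L + c2)"
      by (rule c2[rotated]) (simp add: L(2)[OF B])
    note c1[OF this]
    \<comment> \<open>The output index lies below the length of the final pool, which is
      \<open>card B\<close> plus the number of steps.\<close>
    moreover have "c4 * real (floorlog 2 (snd \<pi>)) \<le> c4 * ?L"
      using c4(1) pool(2) length_replay[OF pool(1)] blist
      by (intro mult_left_mono) (auto simp: index_length_def floorlog_mono intro!: max.coboundedI2)
    moreover have "0 \<le> c4 * (?n * ?L)" "0 \<le> c3 * ?L" "0 \<le> d * (?n * ?L)"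
      using c3(1) c4(1) by (simp_all add: d_def)
    moreover have "c7 + c6 + c5 + c2 + c1 \<le> d * ?L"
    proof -
      have "d * 1 \<le> d * ?L"
        by (intro mult_left_mono) (auto simp: d_def index_length_def)
      then show ?thesis by (simp add: d_def)
    qed
    ultimately show ?thesis
      by (elim produces_mono) (simp add: algebra_simps)
  qed
  moreover have "d + c3 + c4 \<ge> 0"
    using c3(1) c4(1) by (simp add: d_def)
  ultimately show ?thesis by blast
qed

section \<open>Exchange of one premise base for another\<close>

lemma produces_exchange:
  assumes F: "partial_recursive F"
    and inj: "inj_on enc SO"
    and bases: "canonical_base_coding enc SO blist bcode"
  shows "\<exists>c\<ge>0. \<forall>x X Y Z I J k. premise_base SO X \<longrightarrow> premise_base SO Y \<longrightarrow> premise_base SO Z \<longrightarrow>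
     F (prod_encode (bits_code (bcode X), prod_encode (list_encode I, list_encode J)))
       = Some (prod_encode (bits_code (bcode Y), bits_code (bcode Z))) \<longrightarrow>
     produces U x (bcode ((X - Y) \<union> Z)) k \<longrightarrow>
     produces U x (bcode X) (k + c * (1 + real (sum_list (map index_length (I @ J)))))"
proof -
  obtain L where L: "partial_recursive L"
    "\<And>B. premise_base SO B \<Longrightarrow> L (bits_code (bcode B)) = Some (list_code enc (blist B))"
    using bases unfolding canonical_base_coding_def by blast
  \<comment> \<open>Since \<open>G\<close> accepts listings in any order and with repetitions, a
    crude listing of the new base is enough to reach its canonical code.\<close>
  obtain G where G: "partial_recursive G"
    "\<And>ss. premise_base SO (set ss) \<Longrightarrow> G (list_code enc ss) = Some (bits_code (bcode (set ss)))"
    using bases unfolding canonical_base_coding_def by blast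
  obtain c1 where c1: "\<And>x y k. produces U x (unary (bits_code y)) k \<Longrightarrow> produces U x y (k + c1)"
    using produces_to_unary by blast
  obtain c2 where c2: "\<And>x y k. produces U x y k \<Longrightarrow> produces U x (unary (bits_code y)) (k + c2)"
    using produces_from_unary by blast
  have "computable (\<lambda>b. prod_encode (prod_encode (b, 0), 0))"
    by (intro computable_intros)
  from produces_step_computable[OF this] obtain c3 where
    c3: "\<And>x b k. produces U x (unary (prod_encode (prod_encode (b, 0), 0))) k \<Longrightarrow>
       produces U x (unary b) (k + c3)"
    by blast
  let ?gI = "\<lambda>i s. prod_encode (first s,
      prod_encode (cons_code i (first (second s)), second (second s)))"
  let ?gJ = "\<lambda>i s. prod_encode (first s,
      prod_encode (first (second s), cons_code i (second (second s))))"
  have "computable (\<lambda>t. ?gI (second t) (first t))" "computable (\<lambda>t. ?gJ (second t) (first t))"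
    by (intro computable_intros)+
  note this[THEN produces_fold]
  then obtain c4 c5 where c4: "c4 \<ge> 0"
    "\<And>x a is k. produces U x (unary (prod_encode (fold ?gI is a, 0))) k \<Longrightarrow>
      produces U x (unary (prod_encode (a, 0))) (k + c4 * real (sum_list (map index_length is)))"
    and c5: "c5 \<ge> 0"
    "\<And>x a is k. produces U x (unary (prod_encode (fold ?gJ is a, 0))) k \<Longrightarrow>
      produces U x (unary (prod_encode (a, 0))) (k + c5 * real (sum_list (map index_length is)))"
    by blast
  have fold_gI: "fold ?gI is (prod_encode (b, prod_encode (list_encode I, J)))
      = prod_encode (b, prod_encode (list_encode (rev is @ I), J))" for b "is" I J
    by (induction "is" arbitrary: I) (auto simp flip: list_encode.simps)
  have fold_gJ: "fold ?gJ is (prod_encode (b, prod_encode (I, list_encode J)))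
      = prod_encode (b, prod_encode (I, list_encode (rev is @ J)))" for b "is" I J
    by (induction "is" arbitrary: J) (auto simp flip: list_encode.simps)
  \<comment> \<open>Starting from the code of X and the index lists, \<open>?\<Phi>1\<close>
    replaces the lists by the codes of Y and Z, \<open>?\<Phi>2\<close> and \<open>?\<Phi>3\<close>
    replace the codes of X and Y by listings, and \<open>?\<Phi>4\<close> lists Z and forms the
    listing of the new base. In \<open>?\<Phi>\<close>, the empty digit slot is dropped first and
    \<open>G\<close> comes last.\<close>
  let ?\<Phi>1 = "\<lambda>t. map_option (\<lambda>r. prod_encode (first (first (prod_encode (t, r))),
      second (prod_encode (t, r)))) (F t)"
  let ?\<Phi>2 = "\<lambda>t. map_option (\<lambda>r. prod_encode (second (prod_encode (t, r)),
      second (first (prod_encode (t, r))))) (L (first t))"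
  let ?\<Phi>3 = "\<lambda>t. map_option (\<lambda>r. prod_encode (first (first (prod_encode (t, r))),
      prod_encode (second (prod_encode (t, r)), second (second (first (prod_encode (t, r)))))))
      (L (first (second t)))"
  let ?\<Phi>4 = "\<lambda>t. map_option (\<lambda>r. exchange_code (first (first (prod_encode (t, r))))
      (first (second (first (prod_encode (t, r))))) (second (prod_encode (t, r))))
      (L (second (second t)))"
  let ?\<Phi> = "G \<circ>\<^sub>m ?\<Phi>4 \<circ>\<^sub>m ?\<Phi>3 \<circ>\<^sub>m ?\<Phi>2 \<circ>\<^sub>m ?\<Phi>1 \<circ>\<^sub>m (\<lambda>t. Some (first t))"
  have "partial_recursive ?\<Phi>1"
    by (rule partial_recursive_map[OF F, where G = "\<lambda>t. prod_encode (first (first t), second t)"])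
      (intro computable_intros)+
  moreover have "partial_recursive ?\<Phi>2"
    by (rule partial_recursive_map[OF L(1), where G = "\<lambda>t. prod_encode (second t, second (first t))"])
      (intro computable_intros)+
  moreover have "partial_recursive ?\<Phi>3"
    by (rule partial_recursive_map[OF L(1), where G = "\<lambda>t. prod_encode (first (first t),
          prod_encode (second t, second (second (first t))))"])
      (intro computable_intros)+
  moreover have "partial_recursive ?\<Phi>4"
    by (rule partial_recursive_map[OF L(1), where G = "\<lambda>t. exchange_code (first (first t))
          (first (second (first t))) (second t)"])
      (intro computable_intros)+
  ultimately have "partial_recursive ?\<Phi>"
    by (intro partial_recursive.comp[OF partial_recursive.comp[OF partial_recursive.comp[
          OF partial_recursive.comp[OF partial_recursive.comp]]]] G partial_recursive.left)
  from produces_step[OF this] obtain c6 where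
    c6: "\<And>x s t k. ?\<Phi> s = Some t \<Longrightarrow> produces U x (unary t) k \<Longrightarrow> produces U x (unary s) (k + c6)"
    by blast
  define d where "d = max 0 (c2 + c6 + c3 + c1)"
  have "produces U x (bcode X)
      (k + (d + c4 + c5) * (1 + real (sum_list (map index_length (I @ J)))))"
    if X: "premise_base SO X" and Y: "premise_base SO Y" and Z: "premise_base SO Z"
      and F_eq: "F (prod_encode (bits_code (bcode X), prod_encode (list_encode I, list_encode J)))
       = Some (prod_encode (bits_code (bcode Y), bits_code (bcode Z)))"
      and k: "produces U x (bcode ((X - Y) \<union> Z)) k"
    for x X Y Z I J k
  proof -
    let ?s = "prod_encode (bits_code (bcode X), prod_encode (list_encode I, list_encode J))"
    let ?ss = "rev (filter (\<lambda>\<phi>. \<phi> \<notin> Y) (blist X)) @ blist Z"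
    have blist: "set (blist B) = B" if "premise_base SO B" for B
      using bases that unfolding canonical_base_coding_def by blast
    have ss: "set ?ss = (X - Y) \<union> Z"
      using X Z by (auto simp: blist)
    \<comment> \<open>By injectivity on \<open>SO\<close>, the comparison of codes inside
      \<open>exchange_code\<close> decides membership in Y.\<close>
    have "inj_on (bits_code \<circ> enc) SO"
      using inj inj_bits_code by (simp add: comp_inj_on inj_on_subset)
    then have mem: "(bits_code \<circ> enc) \<phi> \<in> set (map (bits_code \<circ> enc) (blist Y)) \<longleftrightarrow> \<phi> \<in> Y"
      if "\<phi> \<in> set (blist X)" for \<phi>
      using that X Y by (auto simp: blist premise_base_def inj_on_def subset_iff simp del: comp_apply)
    have "exchange_code (list_code enc (blist X)) (list_code enc (blist Y)) (list_code enc (blist Z))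
        = list_code enc ?ss"
      unfolding exchange_code filter_map comp_def[of "\<lambda>x. x \<notin> _"]
      using mem by (simp add: rev_map del: set_map comp_apply cong: filter_cong)
    moreover have "G (list_code enc ?ss) = Some (bits_code (bcode ((X - Y) \<union> Z)))"
      using G(2)[of ?ss] X Z unfolding ss by (auto simp: premise_base_def)
    ultimately have "?\<Phi> (prod_encode (?s, 0)) = Some (bits_code (bcode ((X - Y) \<union> Z)))"
      by (simp add: map_comp_def F_eq L(2) X Y Z)
    from c6[OF this c2[OF k]]
    have "produces U x (unary (prod_encode (?s, 0))) (k + c2 + c6)" .
    then have "produces U x (unary (prod_encode (prod_encode (bits_code (bcode X),
        prod_encode (list_encode I, 0)), 0)))
        (k + c2 + c6 + c5 * real (sum_list (map index_length (rev J))))"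
      using fold_gJ[of "rev J" _ _ "[]"] by (intro c5(2)) simp
    then have "produces U x (unary (prod_encode (prod_encode (bits_code (bcode X),
        prod_encode (0, 0)), 0)))
        (k + c2 + c6 + c5 * real (sum_list (map index_length (rev J)))
          + c4 * real (sum_list (map index_length (rev I))))"
      using fold_gI[of "rev I" _ "[]"] by (intro c4(2)) simp
    \<comment> \<open>A pair of empty index lists has code 0, so the start of the construction is
      exactly the state that \<open>c3\<close> prepares from the code of X.\<close>
    moreover have "prod_encode (0, 0) = 0"
      by (simp add: prod_encode_def)
    ultimately have "produces U x (bcode X)
        (k + c2 + c6 + c5 * real (sum_list (map index_length (rev J)))
          + c4 * real (sum_list (map index_length (rev I))) + c3 + c1)"
      by (intro c1 c3) simp
    then show ?thesis
    proof (rule produces_mono)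
      define a b where "a = real (sum_list (map index_length I))"
        and "b = real (sum_list (map index_length J))"
      have "0 \<le> d * (a + b)" "0 \<le> c4 * (1 + b)" "0 \<le> c5 * (1 + a)" "c2 + c6 + c3 + c1 \<le> d"
        using c4(1) c5(1) by (simp_all add: d_def a_def b_def)
      then show "k + c2 + c6 + c5 * real (sum_list (map index_length (rev J)))
          + c4 * real (sum_list (map index_length (rev I))) + c3 + c1
        \<le> k + (d + c4 + c5) * (1 + real (sum_list (map index_length (I @ J))))"
        by (simp flip: rev_map a_def b_def) (simp add: algebra_simps)
    qed
  qed
  moreover have "d + c4 + c5 \<ge> 0"
    using c4(1) c5(1) by (simp add: d_def)
  ultimately show ?thesis by blast
qed

end

section \<open>Traces of derivable formulas, and estimates of logarithms\<close>

lemma replay_append: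
  "replay rules pool (xs @ ys) = Option.bind (replay rules pool xs) (\<lambda>p. replay rules p ys)"
  by (induction rules pool xs rule: replay.induct) (auto split: option.splits)

text \<open>The pool is arbitrary because the premises of a rule are derived one after another, each
  on the pool left by the previous one. Pools only grow, so all premises are available at the end
  and can be named by indices.\<close>

lemma Cn_replay:
  assumes "\<phi> \<in> Cn rules B" "B \<subseteq> set pool"
  shows "\<exists>steps pool'. replay rules pool steps = Some pool' \<and> set pool \<subseteq> set pool' \<and> \<phi> \<in> set pool'"
  using assms
proof (induction arbitrary: pool)
  case (premise \<phi>)
  then show ?case by (intro exI[of _ "[]"] exI[of _ pool]) auto
next
  case (inference R ps \<phi>)
  have "\<exists>steps pool'. replay rules pool steps = Some pool' \<and> set pool \<subseteq> set pool' \<and> set ps \<subseteq> set pool'"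
    using inference.IH inference.prems
  proof (induction ps arbitrary: pool)
    case Nil
    then show ?case by (intro exI[of _ "[]"] exI[of _ pool]) auto
  next
    case (Cons p ps)
    from Cons.prems obtain s1 pool1 where 1: "replay rules pool s1 = Some pool1"
      "set pool \<subseteq> set pool1" "p \<in> set pool1"
      by (meson list.set_intros(1))
    with Cons.prems(2) have "B \<subseteq> set pool1" by blast
    with Cons.IH[of pool1] Cons.prems(1) obtain s2 pool2 where 2: "replay rules pool1 s2 = Some pool2"
      "set pool1 \<subseteq> set pool2" "set ps \<subseteq> set pool2"
      by (auto simp: list.set_intros(2))
    with 1 show ?case
      by (intro exI[of _ "s1 @ s2"] exI[of _ pool2]) (auto simp: replay_append)
  qed
  then obtain steps pool' where s: "replay rules pool steps = Some pool'"
    "set pool \<subseteq> set pool'" "set ps \<subseteq> set pool'" by blast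
  from s(3) have "\<exists>is. ps = map ((!) pool') is \<and> (\<forall>i\<in>set is. i < length pool')"
  proof (induction ps)
    case (Cons p ps)
    then obtain "is" i where "ps = map ((!) pool') is" "\<forall>i\<in>set is. i < length pool'"
      "i < length pool'" "p = pool' ! i"
      by (auto simp: in_set_conv_nth)
    then show ?case by (intro exI[of _ "i # is"]) auto
  qed simp
  moreover from inference.hyps obtain r where "r < length rules" "rules ! r = R"
    by (auto simp: in_set_conv_nth)
  ultimately obtain "is" where "ps = map ((!) pool') is" "\<forall>i\<in>set is. i < length pool'"
    "r < length rules" "rules ! r = R"
    by blast
  with inference.hyps have "replay rules pool' [(r, is)] = Some (pool' @ [\<phi>])"
    by simp
  with s show ?case
    by (intro exI[of _ "steps @ [(r, is)]"] exI[of _ "pool' @ [\<phi>]"]) (auto simp: replay_append)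
qed

text \<open>This makes the minimum in \<open>trace_length\<close> an attained one for derivable
  formulas.\<close>

lemma Cn_derives:
  assumes "q \<in> Cn rules B" "set (blist B) = B"
  shows "\<exists>\<pi>. derives rules blist \<pi> B q"
  using Cn_replay[of q rules B "blist B"] assms by (fastforce simp: derives_def in_set_conv_nth)

text \<open>The sum m + a is at most (1 + c)(m + b), and the additive term log(1 + c) becomes a
  factor because log(m + b) is at least 1. This allows depth and trace length to be exchanged inside
  the logarithm.\<close>

lemma log_add_le:
  fixes a b c m :: real
  assumes "2 \<le> m" "0 \<le> a" "a \<le> c * b" "0 \<le> b" "0 \<le> c"
  shows "log 2 (m + a) \<le> (1 + log 2 (1 + c)) * log 2 (m + b)"
proof -
  have "0 \<le> c * m" using assms by simp
  with assms have "m + a \<le> m + b + c * m + c * b" by linarith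
  then have "m + a \<le> (1 + c) * (m + b)" by (simp add: algebra_simps)
  then have "log 2 (m + a) \<le> log 2 ((1 + c) * (m + b))"
    using assms by (subst log_le_cancel_iff) (auto intro: add_pos_nonneg mult_pos_pos)
  also have "\<dots> = log 2 (1 + c) + log 2 (m + b)"
    using assms by (subst log_mult) auto
  finally have "log 2 (m + a) \<le> log 2 (1 + c) + log 2 (m + b)" .
  moreover have "log 2 (1 + c) * 1 \<le> log 2 (1 + c) * log 2 (m + b)"
    using assms by (intro mult_left_mono) auto
  ultimately show ?thesis by (simp add: algebra_simps)
qed

lemma index_length_le: "2 \<le> M \<Longrightarrow> real (index_length M) \<le> 2 * log 2 (real M)"
proof -
  assume M: "2 \<le> M"
  then have "1 \<le> log 2 (real M)" by simp
  moreover have "real (floorlog 2 M) \<le> log 2 (real M) + 1"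
    using M by (simp add: floorlog_def)
  ultimately show ?thesis by (simp add: index_length_def)
qed

section \<open>Depth against complexity, and stability of complexity under noise\<close>

theorem propositionV1:
  fixes S :: "('s, 'f, 'r) signature"
    and enc :: "('s, 'f, 'r) encoding"
    and rules :: "('s, 'f, 'r) rule list"
    and SO :: "('s, 'f, 'r) fm set"
    and blist :: "('s, 'f, 'r) fm set \<Rightarrow> ('s, 'f, 'r) fm list"
    and bcode :: "('s, 'f, 'r) fm set \<Rightarrow> bits"
    and PO :: "('s, 'f, 'r) fm \<Rightarrow> ('s, 'f, 'r) fm set"
    and U :: machine
    and P :: "real poly"
    and V :: "nat \<Rightarrow> ('s, 'f, 'r) fm list"
    and \<C> :: "(('s, 'f, 'r) fm \<times> ('s, 'f, 'r) fm set) set"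
    and \<delta>\<^sub>0 \<delta> :: real
    and q :: "'i \<Rightarrow> ('s, 'f, 'r) fm"
    and B0 Bminus Bplus Bt :: "'i \<Rightarrow> ('s, 'f, 'r) fm set"
    and m mt \<N> nt n' :: "'i \<Rightarrow> nat"
  assumes system: "effective_proof_system S enc rules"
    and ambient: "effective_ambient_set S enc SO"
    and bases: "canonical_base_coding enc SO blist bcode"
    and depth: "backward_structure enc SO PO"
    and normal_form: "\<And>s B. (s, B) \<in> \<C> \<Longrightarrow> normal_form_premises rules SO PO B"
    and machine: "optimal_prefix_machine U"
    \<comment> \<open>the family of instances\<close>
    and baseline: "\<And>i. premise_base SO (B0 i)"
    and lost: "\<And>i. Bminus i \<subseteq> B0 i"
    and spurious: "\<And>i. finite (Bplus i) \<and> Bplus i \<subseteq> SO - B0 i"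
    and noisy: "\<And>i. Bt i = (B0 i - Bminus i) \<union> Bplus i"
    and m: "\<And>i. m i = card (B0 i)"
    and mt: "\<And>i. mt i = card (Bt i)"
    and \<N>: "\<And>i. \<N> i = card (Bminus i) + card (Bplus i)"
    and nt: "\<And>i. nt i = Dd SO PO (q i) (Bt i)"
    and n': "\<And>i. n' i = trace_length rules blist (q i) (Bt i)"
    and in_class: "\<And>i. (q i, Bt i) \<in> \<C>"
    \<comment> \<open>bounded and effectively describable noise\<close>
    and universes: "computable_universes enc SO P V"
    and bounded: "\<And>i. B0 i \<union> Bplus i \<subseteq> set (V (m i + \<N> i))"
    and describable: "describable_noise bcode V B0 Bminus Bplus"
    \<comment> \<open>the remaining hypotheses\<close>
    and serializable: "serializable rules blist SO PO \<C>"
    and derivable: "\<And>i. q i \<in> SO \<and> q i \<in> Cn rules (Bt i)"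
    and depth_range: "\<And>i. log 2 (real (mt i)) \<le> real (nt i) \<and> real (nt i) \<le> poly P (real (mt i))"
    and information_rich: "information_rich U enc bcode q Bt"
    and \<delta>\<^sub>0: "0 < \<delta>\<^sub>0"
    and rich: "rich rules enc blist SO P \<delta>\<^sub>0"
    and \<delta>: "\<delta>\<^sub>0 < \<delta>" "\<delta> < 1"
    and generic: "\<And>i. (1 - \<delta>) * real (n' i) * log 2 (real (mt i + n' i))
                        \<le> real (KC U (enc (q i)) (bcode (Bt i)))"
  shows "(\<exists>c\<^sub>1 c\<^sub>2. 0 < c\<^sub>1 \<and> 0 < c\<^sub>2 \<and>
            (\<forall>i. 2 \<le> mt i \<longrightarrow>
               c\<^sub>1 * (H_K U enc bcode (q i) (Bt i) / log 2 (real (mt i + nt i)))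
                 \<le> H_derive SO PO (q i) (Bt i) \<and>
               H_derive SO PO (q i) (Bt i)
                 \<le> c\<^sub>2 * (H_K U enc bcode (q i) (Bt i) / log 2 (real (mt i + nt i)))))
       \<and> (\<exists>C. \<forall>i. \<bar>H_K U enc bcode (q i) (Bt i) - H_K U enc bcode (q i) (B0 i)\<bar>
                    \<le> C * real (\<N> i) * log 2 (real (m i + \<N> i)))"
proof -
  have inj: "inj_on enc SO"
    using system ambient unfolding effective_proof_system_def effective_ambient_set_def
    by (elim conjE) (rule inj_on_subset)
  have base: "premise_base SO (Bt i)" "premise_base SO (Bminus i)" "premise_base SO (Bplus i)" for i
    using baseline[of i] lost[of i] spurious[of i]
    by (auto simp: noisy premise_base_def intro: finite_subset)
  define Kt where "Kt i = real (KC U (enc (q i)) (bcode (Bt i)))" for i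
  obtain d where d: "d \<ge> 0"
    "\<And>B q \<pi>. premise_base SO B \<Longrightarrow> derives rules blist \<pi> B q \<Longrightarrow>
     produces U (enc q) (bcode B)
       (d * real (Suc (length (fst \<pi>))) * real (index_length (card B + length (fst \<pi>))))"
    using produces_derivation[OF machine system ambient bases] by blast
  \<comment> \<open>A shortest trace exists by derivability. Besides the upper bound, this shows
    that some program produces the query from the noisy base, so that the minimum in
    \<open>KC\<close> is attained.\<close>
  have trace: "produces U (enc (q i)) (bcode (Bt i))
      (d * real (Suc (n' i)) * real (index_length (mt i + n' i)))" for i
  proof -
    have "set (blist (Bt i)) = Bt i"
      using bases base(1) unfolding canonical_base_coding_def by blast
    with Cn_derives derivable have "\<exists>l \<pi>. length (fst \<pi>) = l \<and> derives rules blist \<pi> (Bt i) (q i)"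
      by metis
    then have "\<exists>\<pi>. length (fst \<pi>) = n' i \<and> derives rules blist \<pi> (Bt i) (q i)"
      unfolding n' trace_length_def by (rule LeastI_ex)
    then show ?thesis
      using d(2)[OF base(1)] mt by metis
  qed
  have "\<exists>c\<^sub>1 c\<^sub>2. 0 < c\<^sub>1 \<and> 0 < c\<^sub>2 \<and>
            (\<forall>i. 2 \<le> mt i \<longrightarrow>
               c\<^sub>1 * (H_K U enc bcode (q i) (Bt i) / log 2 (real (mt i + nt i)))
                 \<le> H_derive SO PO (q i) (Bt i) \<and>
               H_derive SO PO (q i) (Bt i)
                 \<le> c\<^sub>2 * (H_K U enc bcode (q i) (Bt i) / log 2 (real (mt i + nt i))))"
  proof -
    obtain cmin cmax where c: "0 < cmin" "0 < cmax"
      and class_bounds: "\<And>q B. (q, B) \<in> \<C> \<Longrightarrow> q \<in> Cn rules B \<Longrightarrow>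
           cmin * real (Dd SO PO q B) \<le> real (trace_length rules blist q B) \<and>
           real (trace_length rules blist q B) \<le> cmax * real (Dd SO PO q B)"
      using serializable unfolding serializable_def by fast
    have n'_bounds: "cmin * real (nt i) \<le> real (n' i)" "real (n' i) \<le> cmax * real (nt i)" for i
      using class_bounds[OF in_class, of i] derivable[of i] by (simp_all add: nt n')
    \<comment> \<open>In \<open>e\<^sub>1\<close>, the factor 4 comes from \<open>Suc (n' i)\<close>
      being at most twice \<open>n' i\<close> and from \<open>index_length_le\<close>; the added 1
      keeps it positive when d = 0. In \<open>e\<^sub>2\<close>, the division by \<open>cmin\<close>
      turns trace length into depth and that by \<open>1 - \<delta>\<close> inverts genericity; the
      remaining factors of both come from \<open>log_add_le\<close>.\<close>
    define e\<^sub>1 where "e\<^sub>1 = (4 * d + 1) * cmax * (1 + log 2 (1 + cmax))"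
    define e\<^sub>2 where "e\<^sub>2 = (1 + log 2 (1 + 1 / cmin)) / (cmin * (1 - \<delta>))"
    have "0 \<le> log 2 (1 + cmax)" "0 \<le> log 2 (1 + 1 / cmin)" "0 < 4 * d + 1"
      using c d(1) by (simp_all add: add_pos_pos)
    then have "0 < 1 + log 2 (1 + cmax)" "0 < 1 + log 2 (1 + 1 / cmin)" "0 < 4 * d + 1"
      by linarith+
    then have pos: "0 < e\<^sub>1" "0 < e\<^sub>2"
      unfolding e\<^sub>1_def e\<^sub>2_def using c \<delta>(2) by (intro mult_pos_pos divide_pos_pos; linarith)+
    have bounds: "Kt i \<le> e\<^sub>1 * real (nt i) * log 2 (real (mt i + nt i))"
      "real (nt i) * log 2 (real (mt i + nt i)) \<le> e\<^sub>2 * Kt i"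
      "1 \<le> log 2 (real (mt i + nt i))" if i: "2 \<le> mt i" for i
    proof -
      let ?L = "log 2 (real (mt i + n' i))" and ?L' = "log 2 (real (mt i + nt i))"
      \<comment> \<open>With at least two premises the depth range forces a positive depth, hence by
        serializability a trace with at least one step.\<close>
      have "1 \<le> log 2 (real (mt i))" using i by simp
      with depth_range[of i] have "0 < real (nt i)" by linarith
      with c(1) have "0 < cmin * real (nt i)" by simp
      with n'_bounds(1)[of i] have n1: "1 \<le> n' i" by linarith
      have L: "0 \<le> ?L" "1 \<le> ?L'" using i by simp_all
      then show "1 \<le> ?L'" by simp
      have "Kt i \<le> d * real (Suc (n' i)) * real (index_length (mt i + n' i))"
        unfolding Kt_def by (rule KC_le[OF trace])
      also have "\<dots> \<le> d * (2 * real (n' i)) * (2 * ?L)"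
        using d(1) n1 i index_length_le[of "mt i + n' i"] by (intro mult_mono) auto
      also have "\<dots> \<le> (4 * d + 1) * (real (n' i) * ?L)"
        using L by (simp add: algebra_simps)
      also have "\<dots> \<le> (4 * d + 1) * ((cmax * real (nt i)) * ((1 + log 2 (1 + cmax)) * ?L'))"
        using d(1) c L n'_bounds(2)[of i] i log_add_le[of "real (mt i)" "real (n' i)" cmax "real (nt i)"]
        by (intro mult_left_mono mult_mono) auto
      finally show "Kt i \<le> e\<^sub>1 * real (nt i) * ?L'"
        by (simp add: e\<^sub>1_def mult_ac)
      have nt_le: "real (nt i) \<le> 1 / cmin * real (n' i)"
        using n'_bounds(1)[of i] c(1) by (simp add: field_simps)
      then have "real (nt i) * ?L' \<le> (1 / cmin * real (n' i)) * ((1 + log 2 (1 + 1 / cmin)) * ?L)"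
        using c L i log_add_le[of "real (mt i)" "real (nt i)" "1 / cmin" "real (n' i)"]
        by (intro mult_mono) auto
      also have "\<dots> = e\<^sub>2 * ((1 - \<delta>) * real (n' i) * ?L)"
        using c(1) \<delta>(2) by (simp add: e\<^sub>2_def)
      also have "\<dots> \<le> e\<^sub>2 * Kt i"
        using generic[of i] pos by (intro mult_left_mono) (auto simp: Kt_def)
      finally show "real (nt i) * ?L' \<le> e\<^sub>2 * Kt i" .
    qed
    show ?thesis
    \<comment> \<open>The upper bound on the complexity yields the first constant and the lower
      bound the second; the factor ln 2 is common to both entropies.\<close>
    proof (rule exI[of _ "1 / e\<^sub>1"], rule exI[of _ e\<^sub>2], intro conjI allI impI)
      fix i assume i: "2 \<le> mt i"
      note b = bounds[OF i]
      have HK: "H_K U enc bcode (q i) (Bt i) = Kt i * ln 2"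
        and Hd: "H_derive SO PO (q i) (Bt i) = real (nt i) * ln 2"
        by (simp_all add: H_K_def H_derive_def Kt_def nt)
      have "1 / e\<^sub>1 * (Kt i / log 2 (real (mt i + nt i))) \<le> real (nt i)"
        using b(1,3) pos by (simp add: divide_simps mult_ac)
      from mult_right_mono[OF this, of "ln 2"]
      show "1 / e\<^sub>1 * (H_K U enc bcode (q i) (Bt i) / log 2 (real (mt i + nt i)))
          \<le> H_derive SO PO (q i) (Bt i)"
        by (simp add: HK Hd)
      have "real (nt i) \<le> e\<^sub>2 * (Kt i / log 2 (real (mt i + nt i)))"
        using b(2,3) by (simp add: divide_simps)
      from mult_right_mono[OF this, of "ln 2"]
      show "H_derive SO PO (q i) (Bt i)
          \<le> e\<^sub>2 * (H_K U enc bcode (q i) (Bt i) / log 2 (real (mt i + nt i)))"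
        by (simp add: HK Hd)
    qed (use pos in simp_all)
  qed
  moreover have "\<exists>C. \<forall>i. \<bar>H_K U enc bcode (q i) (Bt i) - H_K U enc bcode (q i) (B0 i)\<bar>
      \<le> C * real (\<N> i) * log 2 (real (m i + \<N> i))"
  proof -
    define K0 where "K0 i = real (KC U (enc (q i)) (bcode (B0 i)))" for i
    obtain F F' c where F: "partial_recursive F" "partial_recursive F'"
      and noise: "\<And>i. \<exists>I J. Bminus i = (\<lambda>j. V (m i + \<N> i) ! j) ` set I \<and>
              Bplus i = (\<lambda>j. V (m i + \<N> i) ! j) ` set J \<and>
              real (sum_list (map index_length (I @ J)))
                \<le> c * real (\<N> i) * log 2 (real (m i + \<N> i)) \<and>
              F (prod_encode (bits_code (bcode (B0 i)),
                  prod_encode (list_encode I, list_encode J)))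
                = Some (prod_encode (bits_code (bcode (Bminus i)), bits_code (bcode (Bplus i)))) \<and>
              F' (prod_encode (bits_code (bcode (Bt i)),
                  prod_encode (list_encode I, list_encode J)))
                = Some (prod_encode (bits_code (bcode (Bminus i)), bits_code (bcode (Bplus i))))"
      using describable unfolding describable_noise_def Let_def m[symmetric] \<N>[symmetric] noisy[symmetric]
      by metis
    \<comment> \<open>Going from the noisy base to the baseline removes the spurious premises and
      adds the lost ones, so the two results of \<open>F'\<close> are swapped.\<close>
    let ?F'' = "\<lambda>t. map_option (\<lambda>r. prod_encode (second (second (prod_encode (t, r))),
        first (second (prod_encode (t, r))))) (F' t)"
    have F'': "partial_recursive ?F''"
      by (rule partial_recursive_map[OF F(2), where G = "\<lambda>t. prod_encode (second (second t), first (second t))"])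
        (intro computable_intros)+
    obtain e where e: "e \<ge> 0"
      "\<And>x X Y Z I J k. premise_base SO X \<Longrightarrow> premise_base SO Y \<Longrightarrow> premise_base SO Z \<Longrightarrow>
         F (prod_encode (bits_code (bcode X), prod_encode (list_encode I, list_encode J)))
           = Some (prod_encode (bits_code (bcode Y), bits_code (bcode Z))) \<Longrightarrow>
         produces U x (bcode ((X - Y) \<union> Z)) k \<Longrightarrow>
         produces U x (bcode X) (k + e * (1 + real (sum_list (map index_length (I @ J)))))"
      using produces_exchange[OF machine F(1) inj bases] by blast
    obtain e' where e': "e' \<ge> 0"
      "\<And>x X Y Z I J k. premise_base SO X \<Longrightarrow> premise_base SO Y \<Longrightarrow> premise_base SO Z \<Longrightarrow>
         ?F'' (prod_encode (bits_code (bcode X), prod_encode (list_encode I, list_encode J)))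
           = Some (prod_encode (bits_code (bcode Y), bits_code (bcode Z))) \<Longrightarrow>
         produces U x (bcode ((X - Y) \<union> Z)) k \<Longrightarrow>
         produces U x (bcode X) (k + e' * (1 + real (sum_list (map index_length (I @ J)))))"
      using produces_exchange[OF machine F'' inj bases] by blast
    have diff: "\<bar>Kt i - K0 i\<bar> \<le> 2 * (e + e') * c * real (\<N> i) * log 2 (real (m i + \<N> i))" for i
    \<comment> \<open>Without noise the claimed bound is 0, which leaves no room for a constant;
      here the two bases are equal.\<close>
    proof (cases "\<N> i = 0")
      case True
      then have "Bminus i = {}" "Bplus i = {}"
        using \<N>[of i] base(2,3)[of i] by (auto simp: premise_base_def)
      with True show ?thesis by (simp add: Kt_def K0_def noisy)
    next
      case False
      obtain I J where IJ: "Bminus i = (\<lambda>j. V (m i + \<N> i) ! j) ` set I"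
        "Bplus i = (\<lambda>j. V (m i + \<N> i) ! j) ` set J"
        and \<sigma>: "real (sum_list (map index_length (I @ J)))
                \<le> c * real (\<N> i) * log 2 (real (m i + \<N> i))" (is "?\<sigma> \<le> ?bound")
        and F_eq: "F (prod_encode (bits_code (bcode (B0 i)), prod_encode (list_encode I, list_encode J)))
             = Some (prod_encode (bits_code (bcode (Bminus i)), bits_code (bcode (Bplus i))))"
        and F'_eq: "F' (prod_encode (bits_code (bcode (Bt i)), prod_encode (list_encode I, list_encode J)))
             = Some (prod_encode (bits_code (bcode (Bminus i)), bits_code (bcode (Bplus i))))"
        using noise[of i] by (elim exE conjE) (rule that)
      \<comment> \<open>Nonempty noise needs an index and every index has a digit. Hence the total
        length of the lists is at least 1, and the additive constant costs only a factor 2.\<close>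
      have "I @ J \<noteq> []"
      proof
        assume "I @ J = []"
        with IJ have "Bminus i = {}" "Bplus i = {}"
          by (simp_all only: append_is_Nil_conv list.set image_empty)
        with \<N>[of i] have "\<N> i = 0" by (simp only: card.empty add_0)
        with False show False ..
      qed
      then obtain j js where "I @ J = j # js" by (cases "I @ J") auto
      then have "1 \<le> ?\<sigma>" by (simp add: index_length_def)
      \<comment> \<open>The exchange can be undone because the lost premises lie in the baseline and
        the spurious ones outside it.\<close>
      have Bt: "(B0 i - Bminus i) \<union> Bplus i = Bt i" and B0: "(Bt i - Bplus i) \<union> Bminus i = B0 i"
        using lost[of i] spurious[of i] by (auto simp: noisy)
      have Kt: "produces U (enc (q i)) (bcode (Bt i)) (Kt i)"
        unfolding Kt_def by (rule produces_KC[OF trace])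
      from e(2)[OF baseline base(2,3) F_eq] this
      have K0: "produces U (enc (q i)) (bcode (B0 i)) (Kt i + e * (1 + ?\<sigma>))"
        by (simp add: Bt)
      then have "K0 i \<le> Kt i + e * (1 + ?\<sigma>)"
        unfolding K0_def by (rule KC_le)
      \<comment> \<open>Derivability from the baseline is not assumed. That some program produces
        the query from it, as \<open>produces_KC\<close> requires, follows from the first direction
        of the exchange.\<close>
      moreover have "produces U (enc (q i)) (bcode (Bt i)) (K0 i + e' * (1 + ?\<sigma>))"
        unfolding K0_def
        using e'(2)[OF base(1,3,2)[of i], of I J "enc (q i)"] F'_eq produces_KC[OF K0]
        by (simp add: B0)
      then have "Kt i \<le> K0 i + e' * (1 + ?\<sigma>)"
        unfolding Kt_def by (rule KC_le)
      moreover have "0 \<le> e * (1 + ?\<sigma>)" "0 \<le> e' * (1 + ?\<sigma>)"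
        using e(1) e'(1) by simp_all
      ultimately have "\<bar>Kt i - K0 i\<bar> \<le> (e + e') * (1 + ?\<sigma>)"
        unfolding distrib_right by linarith
      also have "\<dots> \<le> (e + e') * (2 * ?bound)"
        using \<sigma> \<open>1 \<le> ?\<sigma>\<close> e(1) e'(1) by (intro mult_left_mono) auto
      finally show ?thesis by (simp add: algebra_simps)
    qed
    have "\<bar>H_K U enc bcode (q i) (Bt i) - H_K U enc bcode (q i) (B0 i)\<bar>
      \<le> (2 * (e + e') * c * ln 2) * real (\<N> i) * log 2 (real (m i + \<N> i))" for i
    proof -
      have "\<bar>H_K U enc bcode (q i) (Bt i) - H_K U enc bcode (q i) (B0 i)\<bar>
          = \<bar>Kt i - K0 i\<bar> * ln 2"
        by (simp add: H_K_def Kt_def K0_def abs_mult flip: left_diff_distrib)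
      also have "\<dots> \<le> 2 * (e + e') * c * real (\<N> i) * log 2 (real (m i + \<N> i)) * ln 2"
        by (intro mult_right_mono diff) simp
      finally show ?thesis by (simp only: mult_ac)
    qed
    then show ?thesis by blast
  qed
  ultimately show ?thesis ..
qed

end
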